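(* Let $n,m,r,\lambda$ be positive integers with $m>3$ and $n>2m+(\gamma-1)/2$, where $\gamma=\sqrt{8m^2-16m-7}$. Suppose a partial $r$-factorization of $\mathcal G:=\lambda K_m^3$ (with respect to $n$) is given, and assume that if $r=2$ then either $n\ge 3.5m-3$, or every color class of $\mathcal G$ has at most $(2m+\gamma)/5+1$ components. Then the given partial $r$-factorization can be extended to a connected $r$-factorization of $\lambda K_n^3$ if and only if $(n,r,\lambda)$ is $3$-admissible and no component of any color class of $\mathcal G$ is $r$-regular.
   Context: $\lambda K_n^h$: $n$ vertices, every $h$-subset an edge of multiplicity $\lambda$; $\lambda K_m^h$ is its sub-hypergraph induced on a fixed set of $m$ vertices. Degree counts edges containing a vertex. An $r$-factor is a spanning sub-hypergraph in which every vertex has degree $r$. With $k=\lambda\binom{n-1}{h-1}/r$, a partial $r$-factorization of $\lambda K_m^h$ is a coloring of its edges with colors from $[k]$ such that each vertex has degree at most $r$ in every color class (color classes are spanning sub-hypergraphs on all $m$ vertices, possibly edgeless; components include isolated vertices). It extends to a connected $r$-factorization of $\lambda K_n^h$ if some coloring of all edges of $\lambda K_n^h$ with colors from $[k]$ agrees with it on $\lambda K_m^h$ and every color class is a connected $r$-factor. $(n,r,\lambda)$ is $h$-admissible if $h\mid rn$ and $r\mid\lambda\binom{n-1}{h-1}$. *)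

theory Defs
  imports Complex_Main
begin

text \<open>Hypergraphs with multiple edges: the edge \<open>(S, i)\<close> has vertex set \<open>S\<close>, and the label \<open>i\<close>
  only serves to distinguish parallel edges.\<close>

record 'a hypergraph =
  hverts :: "'a set"
  hedges :: "('a set \<times> nat) set"

definition hg_complete :: "nat \<Rightarrow> nat \<Rightarrow> 'a set \<Rightarrow> 'a hypergraph" where
  "hg_complete lam h V =
     \<lparr>hverts = V, hedges = {S. S \<subseteq> V \<and> card S = h} \<times> {..<lam}\<rparr>"

definition hg_induced :: "'a hypergraph \<Rightarrow> 'a set \<Rightarrow> 'a hypergraph" where
  "hg_induced H W = \<lparr>hverts = hverts H \<inter> W, hedges = {e \<in> hedges H. fst e \<subseteq> W}\<rparr>"

definition hg_degree :: "'a hypergraph \<Rightarrow> 'a \<Rightarrow> nat" where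
  "hg_degree H v = card {e \<in> hedges H. v \<in> fst e}"

definition hg_regular :: "nat \<Rightarrow> 'a hypergraph \<Rightarrow> bool" where
  "hg_regular r H \<longleftrightarrow> (\<forall>v \<in> hverts H. hg_degree H v = r)"

definition hg_spanning_sub :: "'a hypergraph \<Rightarrow> 'a hypergraph \<Rightarrow> bool" where
  "hg_spanning_sub F H \<longleftrightarrow> hverts F = hverts H \<and> hedges F \<subseteq> hedges H"

definition hg_factor :: "nat \<Rightarrow> 'a hypergraph \<Rightarrow> 'a hypergraph \<Rightarrow> bool" where
  "hg_factor r F H \<longleftrightarrow> hg_spanning_sub F H \<and> hg_regular r F"

definition hg_adj :: "'a hypergraph \<Rightarrow> ('a \<times> 'a) set" where
  "hg_adj H = {(u, v). \<exists>e \<in> hedges H. u \<in> fst e \<and> v \<in> fst e}"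

definition hg_reach :: "'a hypergraph \<Rightarrow> ('a \<times> 'a) set" where
  "hg_reach H = {(u, v). u \<in> hverts H \<and> v \<in> hverts H \<and> (u, v) \<in> (hg_adj H)\<^sup>*}"

definition hg_components :: "'a hypergraph \<Rightarrow> 'a hypergraph set" where
  "hg_components H = hg_induced H ` (hverts H // hg_reach H)"

definition hg_connected :: "'a hypergraph \<Rightarrow> bool" where
  "hg_connected H \<longleftrightarrow>
     hverts H \<noteq> {} \<and> (\<forall>u \<in> hverts H. \<forall>v \<in> hverts H. (u, v) \<in> hg_reach H)"

definition color_class :: "'a hypergraph \<Rightarrow> ('a set \<times> nat \<Rightarrow> nat) \<Rightarrow> nat \<Rightarrow> 'a hypergraph" where
  "color_class H f c = \<lparr>hverts = hverts H, hedges = {e \<in> hedges H. f e = c}\<rparr>"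

text \<open>The number \<open>k\<close> of colors. If \<open>r\<close> does not divide \<open>\<lambda> * ((n - 1) choose (h - 1))\<close>, then
  \<open>[k]\<close> is read as the set of positive integers not exceeding the rational number \<open>k\<close>,
  which is what the truncating division expresses.\<close>

definition num_colors :: "nat \<Rightarrow> nat \<Rightarrow> nat \<Rightarrow> nat \<Rightarrow> nat" where
  "num_colors h n r lam = lam * ((n - 1) choose (h - 1)) div r"

text \<open>Colorings are total functions on potential edges; only their values on actual edges matter.\<close>

definition hg_coloring :: "nat \<Rightarrow> 'a hypergraph \<Rightarrow> ('a set \<times> nat \<Rightarrow> nat) \<Rightarrow> bool" where
  "hg_coloring k H f \<longleftrightarrow> (\<forall>e \<in> hedges H. f e \<in> {1..k})"

definition partial_factorization ::
    "nat \<Rightarrow> nat \<Rightarrow> 'a hypergraph \<Rightarrow> ('a set \<times> nat \<Rightarrow> nat) \<Rightarrow> bool" where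
  "partial_factorization r k H f \<longleftrightarrow>
     hg_coloring k H f \<and>
     (\<forall>c \<in> {1..k}. \<forall>v \<in> hverts H. hg_degree (color_class H f c) v \<le> r)"

definition connected_factorization ::
    "nat \<Rightarrow> nat \<Rightarrow> 'a hypergraph \<Rightarrow> ('a set \<times> nat \<Rightarrow> nat) \<Rightarrow> bool" where
  "connected_factorization r k H f \<longleftrightarrow>
     hg_coloring k H f \<and>
     (\<forall>c \<in> {1..k}. hg_factor r (color_class H f c) H \<and> hg_connected (color_class H f c))"

definition extends_to_connected_factorization ::
    "nat \<Rightarrow> nat \<Rightarrow> 'a hypergraph \<Rightarrow> 'a hypergraph \<Rightarrow> ('a set \<times> nat \<Rightarrow> nat) \<Rightarrow> bool" where
  "extends_to_connected_factorization r k G H f \<longleftrightarrow>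
     (\<exists>g. (\<forall>e \<in> hedges G. g e = f e) \<and> connected_factorization r k H g)"

definition admissible :: "nat \<Rightarrow> nat \<Rightarrow> nat \<Rightarrow> nat \<Rightarrow> bool" where
  "admissible h n r lam \<longleftrightarrow> h dvd r * n \<and> r dvd lam * ((n - 1) choose (h - 1))"

end

theory Submission
  imports Defs "HOL-Combinatorics.Transposition"
begin

text \<open>Colour first the triples with two vertices in \<open>W\<close> greedily, the size condition guaranteeing a
  free colour; then give the triples with at most one vertex in \<open>W\<close> any colours for which the
  vertices of \<open>W\<close> have degree \<open>r\<close> and the degrees in \<open>V - W\<close> have average \<open>r\<close>.

  The rest is done by exchanging, for \<open>x, y \<in> V - W\<close>, the colours of edges \<open>P \<union> {x}\<close> and \<open>P \<union> {y}\<close>.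
  View such a pair of edges as an arc from the colour of the former to that of the latter.
  Exchanging along a trail from \<open>c\<close> to \<open>d\<close> moves one unit of degree from \<open>x\<close> to \<open>y\<close> in \<open>c\<close> and back
  in \<open>d\<close>, which makes all degrees equal to \<open>r\<close>; exchanging along a closed trail changes no degree.

  If a colour class is disconnected, a count of incidences gives a vertex \<open>x \<in> V - W\<close> with two of
  its edges linked outside \<open>x\<close>, and irregularity of the given components gives a vertex
  \<open>y \<in> V - W\<close> in another component. A closed trail that exchanges exactly one of the two edges then
  merges the components of \<open>x\<close> and \<open>y\<close>, and it can be chosen to keep \<open>x\<close> and \<open>y\<close> connected in
  every class where they already are.\<close>

section \<open>Trails in finite directed multigraphs\<close>

lemma ex_function_with_fibers:
  assumes "finite C" "finite A" "(\<Sum>c\<in>C. q c) = card A"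
  shows "\<exists>h. (\<forall>a\<in>A. h a \<in> C) \<and> (\<forall>c\<in>C. card {a\<in>A. h a = c} = q c)"
  using assms
proof (induction C arbitrary: A rule: finite_induct)
  case empty
  then show ?case by auto
next
  case (insert c C)
  then have "q c \<le> card A" by simp
  then obtain B where B: "B \<subseteq> A" "card B = q c" "finite B"
    by (rule obtain_subset_with_card_n)
  have "(\<Sum>c\<in>C. q c) = card (A - B)"
    using insert B by (simp add: card_Diff_subset)
  with insert.IH[of "A - B"] insert.prems obtain h where
    h: "\<forall>a\<in>A - B. h a \<in> C" "\<forall>d\<in>C. card {a\<in>A - B. h a = d} = q d" by auto
  define h' where "h' a = (if a \<in> B then c else h a)" for a
  have "{a\<in>A. h' a = c} = B" using h B insert.hyps by (auto simp: h'_def)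
  moreover have "{a\<in>A. h' a = d} = {a\<in>A - B. h a = d}" if "d \<in> C" for d
    using that insert.hyps by (auto simp: h'_def)
  ultimately have "\<forall>d\<in>insert c C. card {a\<in>A. h' a = d} = q d" using h B by auto
  moreover have "\<forall>a\<in>A. h' a \<in> insert c C" using h by (auto simp: h'_def)
  ultimately show ?case by blast
qed

lemma card_Collect_remove:
  assumes "finite D" "e \<in> D"
  shows "card {d\<in>D. p d = a} = card {d\<in>D - {e}. p d = a} + (if p e = a then 1 else 0)"
proof -
  have "{d\<in>D. p d = a} = (if p e = a then insert e else id) {d\<in>D - {e}. p d = a}"
    using assms by auto
  then show ?thesis using assms by (cases "p e = a") simp_all
qed

text \<open>Read \<open>t\<close> and \<open>h\<close> as the tail and head of an arc. Leave
  \<open>c\<close> along any arc \<open>e\<close>: either more arcs enter its head than leave it,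
  and the trail stops there, or deleting \<open>e\<close> makes that head a colour with a surplus of
  leaving arcs and induction continues from it. The identity in the conclusion says that
  \<open>J\<close> is balanced up to one extra arc leaving \<open>c\<close> and one extra arc
  entering \<open>d\<close>.\<close>

lemma ex_trail_to_deficit:
  fixes t h :: "'e \<Rightarrow> 'c"
  assumes "finite D" "card {e\<in>D. h e = c} < card {e\<in>D. t e = c}"
  shows "\<exists>J d. J \<subseteq> D \<and> card {e\<in>D. t e = d} < card {e\<in>D. h e = d} \<and>
    (\<forall>a. card {e\<in>J. t e = a} + (if a = d then 1 else 0) =
         card {e\<in>J. h e = a} + (if a = c then 1 else 0))"
  using assms
proof (induction "card D" arbitrary: D c rule: less_induct)
  case less
  have "{e\<in>D. t e = c} \<noteq> {}" using less.prems(2) by (intro notI) simp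
  then obtain e where e: "e \<in> D" "t e = c" by blast
  note rem = card_Collect_remove[OF less.prems(1) e(1)]
  have single: "card {d. d = e \<and> p d = a} = (if a = p e then 1 else 0)" for p :: "'e \<Rightarrow> 'c" and a
  proof -
    have "{d. d = e \<and> p d = a} = (if a = p e then {e} else {})" by auto
    then show ?thesis by simp
  qed
  show ?case
  proof (cases "card {d\<in>D. t d = h e} < card {d\<in>D. h d = h e}")
    case True
    with e single show ?thesis
      by (intro exI[of _ "{e}"] exI[of _ "h e"]) auto
  next
    case False
    let ?D = "D - {e}"
    have "card {d\<in>?D. h d = h e} < card {d\<in>?D. t d = h e}"
      using False less.prems(2) e(2) rem[of h "h e"] rem[of t "h e"] by (auto split: if_splits)
    moreover have "card ?D < card D" using less.prems(1) e(1) by (rule card_Diff1_less)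
    ultimately obtain J d where J: "J \<subseteq> ?D" "card {b\<in>?D. t b = d} < card {b\<in>?D. h b = d}"
      "\<And>a. card {b\<in>J. t b = a} + (if a = d then 1 else 0) =
         card {b\<in>J. h b = a} + (if a = h e then 1 else 0)"
      using less.hyps[of ?D "h e"] less.prems(1) by blast
    have fin: "finite (insert e J)" and J': "insert e J - {e} = J"
      using J(1) less.prems(1) by (auto intro: finite_subset)
    note remJ = card_Collect_remove[OF fin insertI1, unfolded J']
    \<comment> \<open>Putting \<open>e\<close> back adds a leaving arc only at \<open>c\<close>. So
      the deficit at \<open>d\<close> survives unless \<open>d = c\<close>, and that case
      contradicts the surplus at \<open>c\<close>.\<close>
    have "card {b\<in>D. t b = d} < card {b\<in>D. h b = d}"
      using J(2) less.prems(2) e(2) rem[of h d] rem[of t d] by (auto split: if_splits)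
    moreover have "card {b\<in>insert e J. t b = a} + (if a = d then 1 else 0) =
         card {b\<in>insert e J. h b = a} + (if a = c then 1 else 0)" for a
      using J(3)[of a] remJ[of t a] remJ[of h a] e(2) by (auto split: if_splits)
    ultimately show ?thesis using J(1) e(1)
      by (intro exI[of _ "insert e J"] exI[of _ d]) blast
  qed
qed

text \<open>The trail leaves \<open>e0\<close> and follows the transitions \<open>\<pi>\<close> until it returns to the colour \<open>c\<close>.\<close>

lemma ex_closed_trail:
  fixes t h :: "'e \<Rightarrow> 'c"
  assumes fin: "finite D" and e0: "e0 \<in> D" "t e0 = c"
    and bij: "\<And>a. a \<noteq> c \<Longrightarrow> bij_betw (\<pi> a) {e\<in>D. h e = a} {e\<in>D. t e = a}"
  shows "\<exists>J\<subseteq>D. {e\<in>J. t e = c} = {e0} \<and>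
    (\<forall>a. card {e\<in>J. t e = a} = card {e\<in>J. h e = a}) \<and>
    (\<forall>e\<in>D. h e \<noteq> c \<longrightarrow> (\<pi> (h e) e \<in> J \<longleftrightarrow> e \<in> J))"
proof -
  \<comment> \<open>The successor relation of the trail; arcs entering \<open>c\<close> have no
    successor, so the trail stops there.\<close>
  define s where "s = {(e, \<pi> (h e) e) | e. e \<in> D \<and> h e \<noteq> c}"
  define J where "J = {e. (e0, e) \<in> s\<^sup>*}"
  have step: "\<pi> (h e) e \<in> D" "t (\<pi> (h e) e) = h e" if "e \<in> D" "h e \<noteq> c" for e
    using bij_betwE[OF bij[OF that(2)]] that(1) by auto
  have J0: "e = e0 \<or> (\<exists>e'\<in>J \<inter> D. h e' \<noteq> c \<and> e = \<pi> (h e') e')" if "e \<in> J" for e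
    using that unfolding J_def mem_Collect_eq
    by (cases rule: rtranclE) (auto simp: s_def)
  have JD: "J \<subseteq> D"
    using J0 e0 step by blast
  have e0J: "e0 \<in> J" by (simp add: J_def)
  have Jstep: "\<pi> (h e) e \<in> J" if "e \<in> J" "h e \<noteq> c" for e
  proof -
    have "(e, \<pi> (h e) e) \<in> s" using that JD by (auto simp: s_def)
    with that(1) show ?thesis unfolding J_def by (auto intro: rtrancl_into_rtrancl)
  qed
  \<comment> \<open>For the backward direction, a successor has tail different from
    \<open>c\<close>, hence is not \<open>e0\<close> and has a predecessor in \<open>J\<close>;
    injectivity of the transition makes that predecessor \<open>e\<close>.\<close>
  have iff: "\<pi> (h e) e \<in> J \<longleftrightarrow> e \<in> J" if e: "e \<in> D" "h e \<noteq> c" for e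
  proof
    assume "\<pi> (h e) e \<in> J"
    moreover have "\<pi> (h e) e \<noteq> e0" using step(2)[OF e] e0(2) e(2) by auto
    ultimately obtain e' where
      e': "e' \<in> J" "e' \<in> D" "h e' \<noteq> c" "\<pi> (h e) e = \<pi> (h e') e'"
      using J0[of "\<pi> (h e) e"] by auto
    then have "h e = h e'" using step(2)[OF e] step(2)[of e'] by simp
    then have "e = e'"
      using e' e bij_betw_imp_inj_on[OF bij[OF e(2)]] by (auto dest: inj_onD)
    with e' show "e \<in> J" by simp
  qed (use Jstep e in blast)
  have c: "{e\<in>J. t e = c} = {e0}"
  proof -
    have "t e \<noteq> c" if "e \<in> J" "e \<noteq> e0" for e
      using J0[OF that(1)] that(2) step(2) by fastforce
    then show ?thesis using e0(2) e0J by auto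
  qed
  have other: "card {e\<in>J. t e = a} = card {e\<in>J. h e = a}" if a: "a \<noteq> c" for a
  proof -
    have "\<pi> a ` {e\<in>J. h e = a} = {e\<in>J. t e = a}"
    proof (intro subset_antisym subsetI)
      fix e assume "e \<in> \<pi> a ` {e\<in>J. h e = a}"
      then obtain e' where "e' \<in> J" "h e' = a" "e = \<pi> (h e') e'" by blast
      then show "e \<in> {e\<in>J. t e = a}" using Jstep[of e'] step(2)[of e'] a JD by auto
    next
      fix e assume e: "e \<in> {e\<in>J. t e = a}"
      with e0(2) a have "e \<noteq> e0" by auto
      with e J0 obtain e' where e': "e' \<in> J" "e' \<in> D" "h e' \<noteq> c" "e = \<pi> (h e') e'" by blast
      with e step(2)[of e'] have "h e' = a" by simp
      with e' show "e \<in> \<pi> a ` {e\<in>J. h e = a}" by blast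
    qed
    moreover have "inj_on (\<pi> a) {e\<in>J. h e = a}"
      using JD by (intro inj_on_subset[OF bij_betw_imp_inj_on[OF bij[OF a]]]) auto
    ultimately have "bij_betw (\<pi> a) {e\<in>J. h e = a} {e\<in>J. t e = a}"
      by (simp add: bij_betw_def)
    then show ?thesis by (simp add: bij_betw_same_card)
  qed
  have finJ: "finite J" using JD fin by (rule finite_subset)
  \<comment> \<open>Summed over all colours, tails and heads both count \<open>card J\<close>, so
    equality at every other colour forces it at \<open>c\<close>.\<close>
  have "card {e\<in>J. t e = c} = card {e\<in>J. h e = c}"
  proof -
    let ?A = "insert c (t ` J \<union> h ` J)"
    have part: "(\<Sum>a\<in>?A. card {e\<in>J. p e = a}) = card J" if "p ` J \<subseteq> ?A" for p
      using finJ that by (simp add: sum.group[of J ?A p "\<lambda>_. 1::nat", simplified])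
    have "(\<Sum>a\<in>?A. card {e\<in>J. t e = a}) = (\<Sum>a\<in>?A. card {e\<in>J. h e = a})"
      by (rule trans[OF part part[symmetric]]) auto
    moreover have "(\<Sum>a\<in>?A - {c}. card {e\<in>J. t e = a}) = (\<Sum>a\<in>?A - {c}. card {e\<in>J. h e = a})"
      using other by (intro sum.cong) auto
    moreover have "finite ?A" using finJ by simp
    ultimately show ?thesis by (simp add: sum.remove[of ?A c])
  qed
  with other have "\<forall>a. card {e\<in>J. t e = a} = card {e\<in>J. h e = a}" by metis
  with JD c iff show ?thesis by (intro exI[of _ J]) blast
qed

text \<open>Used to force one chosen transition at a colour while the others remain
  arbitrary.\<close>

lemma ex_bij_betw_with_pair:
  assumes "finite A" "finite B" "card A = card B" "a \<in> A" "b \<in> B"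
  shows "\<exists>p. bij_betw p A B \<and> p a = b"
proof -
  have "card (A - {a}) = card (B - {b})" using assms by simp
  then obtain p where p: "bij_betw p (A - {a}) (B - {b})"
    using assms finite_same_card_bij[of "A - {a}" "B - {b}"] by auto
  have "bij_betw (p(a := b)) (A - {a}) (B - {b})"
    using p by (rule bij_betw_cong[THEN iffD1, rotated]) simp
  then have "bij_betw (p(a := b)) (insert a (A - {a})) (insert b (B - {b}))"
    using notIn_Un_bij_betw[of a "A - {a}" "p(a := b)" "B - {b}"] by simp
  then show ?thesis using assms by (intro exI[of _ "p(a := b)"]) (simp add: insert_absorb)
qed

section \<open>Exchanging the colours of edges at two vertices\<close>

definition col_adj :: "('a set \<times> nat) set \<Rightarrow> ('a set \<times> nat \<Rightarrow> nat) \<Rightarrow> nat \<Rightarrow> ('a \<times> 'a) set" where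
  "col_adj E g c = {(u, v). \<exists>e\<in>E. g e = c \<and> u \<in> fst e \<and> v \<in> fst e}"

definition col_deg :: "('a set \<times> nat) set \<Rightarrow> ('a set \<times> nat \<Rightarrow> nat) \<Rightarrow> nat \<Rightarrow> 'a \<Rightarrow> nat" where
  "col_deg E g c v = card {e\<in>E. g e = c \<and> v \<in> fst e}"

text \<open>Only the vertices of the walk have to avoid \<open>A\<close>. An edge that meets
  \<open>A\<close> still links its remaining vertices, and this makes links stable under exchanges
  at the vertices of \<open>A\<close>.\<close>

definition link_avoiding ::
    "('a set \<times> nat) set \<Rightarrow> ('a set \<times> nat \<Rightarrow> nat) \<Rightarrow> nat \<Rightarrow> 'a set \<Rightarrow> ('a \<times> 'a) set" where
  "link_avoiding E g c A =
     {(u, v). u \<notin> A \<and> v \<notin> A \<and> (u, v) \<in> {(u, v) \<in> col_adj E g c. u \<notin> A \<and> v \<notin> A}\<^sup>*}"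

lemma col_adjI: "e \<in> E \<Longrightarrow> g e = c \<Longrightarrow> u \<in> fst e \<Longrightarrow> v \<in> fst e \<Longrightarrow> (u, v) \<in> col_adj E g c"
  by (auto simp: col_adj_def)

lemma sym_col_adj: "sym (col_adj E g c)"
  by (auto simp: sym_def col_adj_def)

lemma col_reach_sym: "(u, v) \<in> (col_adj E g c)\<^sup>* \<Longrightarrow> (v, u) \<in> (col_adj E g c)\<^sup>*"
  using sym_rtrancl[OF sym_col_adj] by (rule symD)

lemma reach_between:
  "(x, u) \<in> R \<Longrightarrow> (u, v) \<in> R\<^sup>* \<Longrightarrow> (v, y) \<in> R \<Longrightarrow> (x, y) \<in> R\<^sup>*"
  by (rule converse_rtrancl_into_rtrancl, assumption, rule rtrancl_into_rtrancl)

lemma link_avoiding_refl: "u \<notin> A \<Longrightarrow> (u, u) \<in> link_avoiding E g c A"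
  by (simp add: link_avoiding_def)

lemma link_avoiding_step:
  "(u, v) \<in> col_adj E g c \<Longrightarrow> u \<notin> A \<Longrightarrow> (v, w) \<in> link_avoiding E g c A \<Longrightarrow>
   (u, w) \<in> link_avoiding E g c A"
  unfolding link_avoiding_def by (auto intro: converse_rtrancl_into_rtrancl)

lemma link_avoiding_snoc:
  "(u, v) \<in> link_avoiding E g c A \<Longrightarrow> (v, w) \<in> col_adj E g c \<Longrightarrow> w \<notin> A \<Longrightarrow>
   (u, w) \<in> link_avoiding E g c A"
  unfolding link_avoiding_def by (auto intro: rtrancl_into_rtrancl)

lemma link_avoiding_sym:
  "(u, v) \<in> link_avoiding E g c A \<Longrightarrow> (v, u) \<in> link_avoiding E g c A"
proof -
  have "sym ({(u, v) \<in> col_adj E g c. u \<notin> A \<and> v \<notin> A}\<^sup>*)"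
    by (rule sym_rtrancl) (auto simp: sym_def col_adj_def)
  then show "(u, v) \<in> link_avoiding E g c A \<Longrightarrow> (v, u) \<in> link_avoiding E g c A"
    by (auto simp: link_avoiding_def dest: symD)
qed

lemma link_avoiding_trans:
  "(u, v) \<in> link_avoiding E g c A \<Longrightarrow> (v, w) \<in> link_avoiding E g c A \<Longrightarrow>
   (u, w) \<in> link_avoiding E g c A"
  unfolding link_avoiding_def by auto

lemma link_avoiding_notin: "(u, v) \<in> link_avoiding E g c A \<Longrightarrow> u \<notin> A \<and> v \<notin> A"
  by (simp add: link_avoiding_def)

lemma link_avoiding_reach: "(u, v) \<in> link_avoiding E g c A \<Longrightarrow> (u, v) \<in> (col_adj E g c)\<^sup>*"
proof -
  have "{(u, v) \<in> col_adj E g c. u \<notin> A \<and> v \<notin> A}\<^sup>* \<subseteq> (col_adj E g c)\<^sup>*"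
    by (rule rtrancl_mono) auto
  then show "(u, v) \<in> link_avoiding E g c A \<Longrightarrow> (u, v) \<in> (col_adj E g c)\<^sup>*"
    by (auto simp: link_avoiding_def)
qed

lemma link_avoiding_mono:
  assumes "{(u, v) \<in> col_adj E g c. u \<notin> A \<and> v \<notin> A} \<subseteq> {(u, v) \<in> col_adj E g' c. u \<notin> A \<and> v \<notin> A}"
  shows "link_avoiding E g c A \<subseteq> link_avoiding E g' c A"
  using rtrancl_mono[OF assms] by (auto simp: link_avoiding_def)

lemma link_avoiding_antimono:
  assumes "A \<subseteq> B" "(u, v) \<in> link_avoiding E g c B"
  shows "(u, v) \<in> link_avoiding E g c A"
proof -
  have "{(u, v) \<in> col_adj E g c. u \<notin> B \<and> v \<notin> B}\<^sup>* \<subseteq> {(u, v) \<in> col_adj E g c. u \<notin> A \<and> v \<notin> A}\<^sup>*"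
    using assms(1) by (intro rtrancl_mono) auto
  with assms show ?thesis by (auto simp: link_avoiding_def)
qed

text \<open>A walk never leaves the component of \<open>u\<close>, so it avoids every vertex outside
  that component for free.\<close>

lemma link_avoiding_unreachable:
  assumes "(u, v) \<in> link_avoiding E g c A" "\<And>b. b \<in> B \<Longrightarrow> (u, b) \<notin> (col_adj E g c)\<^sup>*"
  shows "(u, v) \<in> link_avoiding E g c (A \<union> B)"
proof -
  let ?r = "{(u, v) \<in> col_adj E g c. u \<notin> A \<and> v \<notin> A}"
  have "(u, v) \<in> ?r\<^sup>*" and uA: "u \<notin> A" using assms(1) by (auto simp: link_avoiding_def)
  then show ?thesis
  proof induction
    case base
    then show ?case using assms(2)[of u] by (auto intro: link_avoiding_refl)
  next
    case (step v w)
    then have vw: "(v, w) \<in> col_adj E g c" "w \<notin> A" by auto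
    have "(u, v) \<in> (col_adj E g c)\<^sup>*" using step.IH uA by (intro link_avoiding_reach) 
    then have "(u, w) \<in> (col_adj E g c)\<^sup>*" using vw(1) by (rule rtrancl_into_rtrancl)
    then have "w \<notin> B" using assms(2) by blast
    with vw step.IH uA show ?case by (auto intro: link_avoiding_snoc)
  qed
qed

lemma sum_col_deg:
  assumes "finite E" "finite X"
  shows "(\<Sum>v\<in>X. col_deg E g c v) = (\<Sum>e | e \<in> E \<and> g e = c. card (fst e \<inter> X))"
proof -
  have "(\<Sum>v\<in>X. col_deg E g c v) = (\<Sum>v\<in>X. \<Sum>e | e \<in> E \<and> g e = c. if v \<in> fst e then 1 else 0)"
    using assms unfolding col_deg_def by (intro sum.cong) (auto simp: sum.If_cases Int_def conj_assoc)
  also have "\<dots> = (\<Sum>e | e \<in> E \<and> g e = c. \<Sum>v\<in>X. if v \<in> fst e then 1 else 0)"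
    by (rule sum.swap)
  also have "\<dots> = (\<Sum>e | e \<in> E \<and> g e = c. card (fst e \<inter> X))"
    using assms by (intro sum.cong) (auto simp: sum.If_cases Int_def conj_commute)
  finally show ?thesis .
qed

lemma sum_col_deg_colors:
  assumes "finite E" "finite C" "g ` E \<subseteq> C"
  shows "(\<Sum>c\<in>C. col_deg E g c v) = card {e\<in>E. v \<in> fst e}"
proof -
  have "(\<Sum>c\<in>C. \<Sum>e | e \<in> {e\<in>E. v \<in> fst e} \<and> g e = c. 1::nat) = (\<Sum>e\<in>{e\<in>E. v \<in> fst e}. 1)"
    using assms by (intro sum.group) auto
  moreover have "{e \<in> {e\<in>E. v \<in> fst e}. g e = c} = {e\<in>E. g e = c \<and> v \<in> fst e}" for c by auto
  ultimately show ?thesis by (simp add: col_deg_def)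
qed

section \<open>Effect of an exchange on degrees and on connectivity\<close>

locale vertex_swap =
  fixes E :: "('a set \<times> nat) set" and x y :: 'a
  assumes finite_E: "finite E" and x_neq_y: "x \<noteq> y"
    and closed: "e \<in> E \<Longrightarrow> map_prod (image (transpose x y)) id e \<in> E"
begin

definition sw :: "'a set \<times> nat \<Rightarrow> 'a set \<times> nat" where
  "sw = map_prod (image (transpose x y)) id"

text \<open>A pair \<open>P \<union> {x}\<close>, \<open>P \<union> {y}\<close> is represented by
  its member at \<open>x\<close>; under a colouring \<open>g\<close> the arc \<open>e\<close> runs
  from \<open>g e\<close> to \<open>g (sw e)\<close>.\<close>

definition arcs :: "('a set \<times> nat) set" where
  "arcs = {e\<in>E. x \<in> fst e \<and> y \<notin> fst e}"

definition recolor ::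
    "('a set \<times> nat) set \<Rightarrow> ('a set \<times> nat \<Rightarrow> nat) \<Rightarrow> 'a set \<times> nat \<Rightarrow> nat" where
  "recolor J g e = (if e \<in> J \<or> sw e \<in> J then g (sw e) else g e)"

lemma sw_sw [simp]: "sw (sw e) = e"
  by (cases e) (simp add: sw_def image_image)

lemma sw_eq_iff [simp]: "sw e = sw e' \<longleftrightarrow> e = e'"
  using sw_sw by metis

lemma inj_sw: "inj_on sw A"
  by (auto simp: inj_on_def)

lemma sw_in_E_iff [simp]: "sw e \<in> E \<longleftrightarrow> e \<in> E"
  using closed sw_sw unfolding sw_def by metis

lemma in_sw_iff: "v \<in> fst (sw e) \<longleftrightarrow> transpose x y v \<in> fst e"
  by (cases e) (auto simp: sw_def in_transpose_image_iff)

lemma x_in_sw [simp]: "x \<in> fst (sw e) \<longleftrightarrow> y \<in> fst e"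
  and y_in_sw [simp]: "y \<in> fst (sw e) \<longleftrightarrow> x \<in> fst e"
  by (simp_all add: in_sw_iff)

lemma other_in_sw [simp]: "v \<noteq> x \<Longrightarrow> v \<noteq> y \<Longrightarrow> v \<in> fst (sw e) \<longleftrightarrow> v \<in> fst e"
  by (simp add: in_sw_iff transpose_def)

lemma arcs_subset: "arcs \<subseteq> E"
  and finite_arcs: "finite arcs"
  using finite_E by (auto simp: arcs_def)

text \<open>Edges containing both vertices count equally for \<open>x\<close> and \<open>y\<close>.
  The other edges of colour \<open>a\<close> at \<open>x\<close> are the arcs leaving
  \<open>a\<close>, those at \<open>y\<close> are the partners of the arcs entering
  \<open>a\<close>. So a degree difference is a surplus of arcs.\<close>

lemma balance:
  "col_deg E g a x + card {e\<in>arcs. g (sw e) = a} = col_deg E g a y + card {e\<in>arcs. g e = a}"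
proof -
  let ?B = "{e\<in>E. g e = a \<and> x \<in> fst e \<and> y \<in> fst e}"
  let ?Y = "{e\<in>E. g e = a \<and> y \<in> fst e \<and> x \<notin> fst e}"
  have "{e\<in>E. g e = a \<and> x \<in> fst e} = ?B \<union> {e\<in>arcs. g e = a}" by (auto simp: arcs_def)
  then have x: "col_deg E g a x = card ?B + card {e\<in>arcs. g e = a}"
    unfolding col_deg_def using finite_E finite_arcs
    by (subst card_Un_disjoint[symmetric]) (auto simp: arcs_def)
  have "{e\<in>E. g e = a \<and> y \<in> fst e} = ?B \<union> ?Y" by auto
  then have "col_deg E g a y = card ?B + card ?Y"
    unfolding col_deg_def using finite_E by (subst card_Un_disjoint[symmetric]) auto
  moreover have "bij_betw sw {e\<in>arcs. g (sw e) = a} ?Y"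
    by (rule bij_betw_byWitness[where f' = sw]) (auto simp: arcs_def)
  ultimately show ?thesis using x by (simp add: bij_betw_same_card)
qed

context
  fixes J :: "('a set \<times> nat) set"
  assumes J: "J \<subseteq> arcs"
begin

lemma recolor_x: "x \<in> fst e \<Longrightarrow> recolor J g e = (if e \<in> J then g (sw e) else g e)"
  and recolor_y: "y \<in> fst e \<Longrightarrow> recolor J g e = (if sw e \<in> J then g (sw e) else g e)"
  and recolor_untouched: "x \<notin> fst e \<Longrightarrow> y \<notin> fst e \<Longrightarrow> recolor J g e = g e"
  and recolor_common: "x \<in> fst e \<Longrightarrow> y \<in> fst e \<Longrightarrow> recolor J g e = g e"
  using J by (auto simp: recolor_def arcs_def)

lemma recolor_sw: "e \<in> J \<or> sw e \<in> J \<Longrightarrow> recolor J g (sw e) = g e"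
  by (auto simp: recolor_def)

lemma recolor_image: "g ` E \<subseteq> C \<Longrightarrow> recolor J g ` E \<subseteq> C"
  by (auto simp: recolor_def)

lemma col_deg_recolor_other:
  assumes "v \<noteq> x" "v \<noteq> y"
  shows "col_deg E (recolor J g) a v = col_deg E g a v"
proof -
  \<comment> \<open>An involution of the edges that respects membership of \<open>v\<close>; the new
    colouring is the old one composed with it.\<close>
  define s where "s e = (if e \<in> J \<or> sw e \<in> J then sw e else e)" for e
  have s: "s (s e) = e" "s e \<in> E \<longleftrightarrow> e \<in> E" "v \<in> fst (s e) \<longleftrightarrow> v \<in> fst e"
    "recolor J g e = g (s e)" for e
    using assms by (auto simp: s_def recolor_def)
  have "bij_betw s {e\<in>E. recolor J g e = a \<and> v \<in> fst e} {e\<in>E. g e = a \<and> v \<in> fst e}"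
    by (rule bij_betw_byWitness[where f' = s]) (auto simp: s)
  then show ?thesis by (simp add: col_deg_def bij_betw_same_card)
qed

lemma col_deg_recolor_x:
  "col_deg E (recolor J g) a x + card {e\<in>J. g e = a} =
   col_deg E g a x + card {e\<in>J. g (sw e) = a}"
proof -
  let ?R = "{e\<in>E - J. g e = a \<and> x \<in> fst e}"
  have fin: "finite J" using J finite_arcs by (rule finite_subset)
  have "{e\<in>E. recolor J g e = a \<and> x \<in> fst e} = ?R \<union> {e\<in>J. g (sw e) = a}"
    using J by (auto simp: recolor_x arcs_def)
  then have 1: "col_deg E (recolor J g) a x = card ?R + card {e\<in>J. g (sw e) = a}"
    unfolding col_deg_def using finite_E fin by (subst card_Un_disjoint[symmetric]) auto
  have "{e\<in>E. g e = a \<and> x \<in> fst e} = ?R \<union> {e\<in>J. g e = a}"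
    using J by (auto simp: arcs_def)
  then have "col_deg E g a x = card ?R + card {e\<in>J. g e = a}"
    unfolding col_deg_def using finite_E fin by (subst card_Un_disjoint[symmetric]) auto
  with 1 show ?thesis by simp
qed

lemma col_deg_recolor_y:
  "col_deg E (recolor J g) a y + card {e\<in>J. g (sw e) = a} =
   col_deg E g a y + card {e\<in>J. g e = a}"
proof -
  let ?R = "{e\<in>E. sw e \<notin> J \<and> g e = a \<and> y \<in> fst e}"
  have fin: "finite J" using J finite_arcs by (rule finite_subset)
  have sJ: "e \<in> sw ` A \<longleftrightarrow> sw e \<in> A" for e A by (metis imageI imageE sw_sw)
  have JE: "sw e \<in> J \<Longrightarrow> e \<in> E \<and> y \<in> fst e" for e using J by (auto simp: arcs_def)
  have "{e\<in>E. recolor J g e = a \<and> y \<in> fst e} = ?R \<union> sw ` {e\<in>J. g e = a}"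
    unfolding set_eq_iff Un_iff sJ mem_Collect_eq using JE by (auto simp: recolor_y split: if_splits)
  then have 1: "col_deg E (recolor J g) a y = card ?R + card {e\<in>J. g e = a}"
    unfolding col_deg_def using finite_E fin
    by (subst card_image[OF inj_sw, symmetric], subst card_Un_disjoint[symmetric])
      (auto simp: disjoint_iff sJ simp del: image_iff)
  have "{e\<in>E. g e = a \<and> y \<in> fst e} = ?R \<union> sw ` {e\<in>J. g (sw e) = a}"
    unfolding set_eq_iff Un_iff sJ mem_Collect_eq using JE by auto
  then have "col_deg E g a y = card ?R + card {e\<in>J. g (sw e) = a}"
    unfolding col_deg_def using finite_E fin
    by (subst card_image[OF inj_sw, symmetric], subst card_Un_disjoint[symmetric])
      (auto simp: disjoint_iff sJ simp del: image_iff)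
  with 1 show ?thesis by simp
qed

text \<open>An edge and its partner agree outside \<open>x\<close> and \<open>y\<close>, so
  whichever of them now carries colour \<open>a\<close> provides the same step.\<close>

lemma link_avoiding_recolor:
  "link_avoiding E g a {x, y} \<subseteq> link_avoiding E (recolor J g) a {x, y}"
proof (rule link_avoiding_mono, clarsimp)
  fix u v assume uv: "(u, v) \<in> col_adj E g a" "u \<noteq> x" "u \<noteq> y" "v \<noteq> x" "v \<noteq> y"
  then obtain e where e: "e \<in> E" "g e = a" "u \<in> fst e" "v \<in> fst e" by (auto simp: col_adj_def)
  show "(u, v) \<in> col_adj E (recolor J g) a"
  proof (cases "e \<in> J \<or> sw e \<in> J")
    case True
    with uv e show ?thesis by (intro col_adjI[of "sw e"]) (simp_all add: recolor_sw)
  next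
    case False
    with e show ?thesis by (intro col_adjI[of e]) (simp_all add: recolor_def)
  qed
qed

text \<open>Follow the old walk from \<open>u\<close>. When it first uses an exchanged edge, the
  partner of that edge now has colour \<open>a\<close> and contains \<open>x\<close> or
  \<open>y\<close>, so the target is reached there.\<close>

lemma reach_recolor_touching:
  fixes g a defines "R \<equiv> (col_adj E (recolor J g) a)\<^sup>*"
  assumes "(u, x) \<in> (col_adj E g a)\<^sup>* \<or> (u, y) \<in> (col_adj E g a)\<^sup>*"
  shows "(u, x) \<in> R \<or> (u, y) \<in> R"
proof -
  have step: "(u, x) \<in> R \<or> (u, y) \<in> R"
    if uv: "(u, v) \<in> col_adj E g a" and v: "(v, x) \<in> R \<or> (v, y) \<in> R" for u v
  proof (cases "u = x \<or> u = y")
    case True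
    then show ?thesis by (auto simp: R_def)
  next
    case False
    obtain e where e: "e \<in> E" "g e = a" "u \<in> fst e" "v \<in> fst e" using uv by (auto simp: col_adj_def)
    show ?thesis
    proof (cases "e \<in> J \<or> sw e \<in> J")
      case True
      then have "x \<in> fst (sw e) \<or> y \<in> fst (sw e)" using J by (auto simp: arcs_def)
      moreover have "sw e \<in> E" "recolor J g (sw e) = a" "u \<in> fst (sw e)"
        using e False True by (simp_all add: recolor_sw)
      ultimately show ?thesis unfolding R_def by (meson col_adjI r_into_rtrancl)
    next
      case False
      then have "(u, v) \<in> col_adj E (recolor J g) a"
        using e by (intro col_adjI[of e]) (simp_all add: recolor_def)
      with v show ?thesis unfolding R_def by (auto intro: converse_rtrancl_into_rtrancl)
    qed
  qed
  have "(u, z) \<in> (col_adj E g a)\<^sup>* \<Longrightarrow> z = x \<or> z = y \<Longrightarrow> (u, x) \<in> R \<or> (u, y) \<in> R" for z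
    by (induction rule: converse_rtrancl_induct) (auto simp: R_def dest: step[unfolded R_def])
  with assms(2) show ?thesis by blast
qed

lemma reach_recolor_other:
  assumes "(u, v) \<in> (col_adj E g a)\<^sup>*"
    "(u, x) \<notin> (col_adj E g a)\<^sup>*" "(u, y) \<notin> (col_adj E g a)\<^sup>*"
  shows "(u, v) \<in> (col_adj E (recolor J g) a)\<^sup>*"
  using assms(1)
proof induction
  case (step v w)
  then obtain e where e: "e \<in> E" "g e = a" "v \<in> fst e" "w \<in> fst e" by (auto simp: col_adj_def)
  have "x \<notin> fst e" "y \<notin> fst e"
    using assms(2,3) step.hyps(1) e by (meson col_adjI rtrancl_into_rtrancl)+
  then have "(v, w) \<in> col_adj E (recolor J g) a"
    using e by (intro col_adjI[of e]) (simp_all add: recolor_untouched)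
  with step.IH show ?case by simp
qed simp

text \<open>Components meeting neither vertex are untouched, and vertices of the others still reach
  \<open>x\<close> or \<open>y\<close>. Hence no connection is lost once \<open>x\<close> and
  \<open>y\<close> are joined afterwards.\<close>

lemma reach_recolor_mono:
  assumes "(x, y) \<in> (col_adj E (recolor J g) a)\<^sup>*"
  shows "(col_adj E g a)\<^sup>* \<subseteq> (col_adj E (recolor J g) a)\<^sup>*"
proof (clarify)
  fix u v assume uv: "(u, v) \<in> (col_adj E g a)\<^sup>*"
  let ?R = "(col_adj E g a)\<^sup>*" and ?R' = "(col_adj E (recolor J g) a)\<^sup>*"
  show "(u, v) \<in> ?R'"
  proof (cases "(u, x) \<in> ?R \<or> (u, y) \<in> ?R")
    case True
    then have v: "(v, x) \<in> ?R \<or> (v, y) \<in> ?R"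
      using rtrancl_trans[OF col_reach_sym[OF uv]] by blast
    have yx: "(y, x) \<in> ?R'" using assms by (rule col_reach_sym)
    have ux: "(w, x) \<in> ?R'" if "(w, x) \<in> ?R \<or> (w, y) \<in> ?R" for w
      using reach_recolor_touching[OF that] rtrancl_trans[OF _ yx] by blast
    show ?thesis using rtrancl_trans[OF ux[OF True] col_reach_sym[OF ux]] v by blast
  next
    case False
    with uv show ?thesis by (intro reach_recolor_other) auto
  qed
qed

end

end

section \<open>Merging two components by a closed trail\<close>

context vertex_swap
begin

text \<open>Take the stretch of a walk from its last visit to \<open>x\<close> before
  \<open>y\<close> up to \<open>y\<close>. No edge contains both, so its first and last edges give
  arcs: \<open>e1\<close> leaves \<open>a\<close>, and the last edge is \<open>sw e2\<close> for an
  arc \<open>e2\<close> entering \<open>a\<close>.\<close>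

lemma ex_linked_arcs:
  assumes "(x, y) \<in> (col_adj E g a)\<^sup>*" "\<not> (\<exists>e\<in>E. g e = a \<and> x \<in> fst e \<and> y \<in> fst e)"
  obtains e1 e2 u1 u2 where "e1 \<in> arcs" "g e1 = a" "u1 \<in> fst e1"
    "e2 \<in> arcs" "g (sw e2) = a" "u2 \<in> fst (sw e2)" "(u1, u2) \<in> link_avoiding E g a {x, y}"
proof -
  let ?L = "link_avoiding E g a {x, y}"
  define G where "G \<longleftrightarrow> (\<exists>e1 e2 u1 u2. e1 \<in> E \<and> g e1 = a \<and> x \<in> fst e1 \<and> u1 \<in> fst e1 \<and>
    e2 \<in> E \<and> g e2 = a \<and> y \<in> fst e2 \<and> u2 \<in> fst e2 \<and> (u1, u2) \<in> ?L)"
  \<comment> \<open>Invariant along the walk: it stands at \<open>x\<close>, or it is linked outside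
    \<open>{x, y}\<close> to an edge at \<open>x\<close>, or the required pair of edges has been
    found.\<close>
  have "v = x \<or> (\<exists>e1 u1. e1 \<in> E \<and> g e1 = a \<and> x \<in> fst e1 \<and> u1 \<in> fst e1 \<and> (u1, v) \<in> ?L) \<or> G"
    if "(x, v) \<in> (col_adj E g a)\<^sup>*" for v
    using that
  proof induction
    case (step v w)
    then obtain e where e: "e \<in> E" "g e = a" "v \<in> fst e" "w \<in> fst e" by (auto simp: col_adj_def)
    consider "w = x" | "w = y" | "w \<noteq> x" "w \<noteq> y" by blast
    then show ?case
    proof cases
      case 2
      with e assms(2) have "v \<noteq> x" by blast
      with step.IH 2 e show ?thesis unfolding G_def by blast
    next
      case 3
      show ?thesis
      proof (cases "v = x")
        case True
        with e 3 link_avoiding_refl[of w "{x, y}" E g a] show ?thesis by blast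
      next
        case False
        with step.IH link_avoiding_snoc[OF _ step.hyps(2), of _ "{x, y}"] 3 show ?thesis by blast
      qed
    qed simp
  qed simp
  from this[OF assms(1)] have G using x_neq_y by (auto dest: link_avoiding_notin)
  then obtain e1 e2 u1 u2 where e: "e1 \<in> E" "g e1 = a" "x \<in> fst e1" "u1 \<in> fst e1"
    "e2 \<in> E" "g e2 = a" "y \<in> fst e2" "u2 \<in> fst e2" "(u1, u2) \<in> ?L" unfolding G_def by blast
  with assms(2) have "e1 \<in> arcs" "sw e2 \<in> arcs" by (auto simp: arcs_def)
  with e show ?thesis by (intro that[of e1 u1 "sw e2" u2]) auto
qed

text \<open>In every colour class other than \<open>c\<close> in which \<open>x\<close> and \<open>y\<close> are connected, an edge at \<open>x\<close> and
  an edge at \<open>y\<close> that are linked outside \<open>{x, y}\<close> are made consecutive on the trail. They are then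
  exchanged together or not at all, so their link still joins \<open>x\<close> to \<open>y\<close>.\<close>

lemma ex_merging_recoloring:
  assumes deg: "\<And>a. col_deg E g a x = col_deg E g a y"
    and unlinked: "(x, y) \<notin> (col_adj E g c)\<^sup>*"
    and e0: "e0 \<in> E" "g e0 = c" "x \<in> fst e0" "u0 \<in> fst e0"
    and e1: "e1 \<in> E" "g e1 = c" "x \<in> fst e1" "u1 \<in> fst e1"
    and "e0 \<noteq> e1" and link: "(u0, u1) \<in> link_avoiding E g c {x}"
  shows "\<exists>J\<subseteq>arcs. (\<forall>a v. col_deg E (recolor J g) a v = col_deg E g a v) \<and>
    (\<forall>a. a = c \<or> (x, y) \<in> (col_adj E g a)\<^sup>* \<longrightarrow> (x, y) \<in> (col_adj E (recolor J g) a)\<^sup>*)"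
proof -
  let ?out = "\<lambda>a. {e\<in>arcs. g e = a}" and ?in = "\<lambda>a. {e\<in>arcs. g (sw e) = a}"
  let ?L = "\<lambda>a. link_avoiding E g a {x, y}"
  have bal: "card (?in a) = card (?out a)" for a using balance[of g a] deg[of a] by simp
  \<comment> \<open>If an edge of colour \<open>a\<close> contains both \<open>x\<close> and
    \<open>y\<close>, no pairing is required, since such an edge is never exchanged.\<close>
  define joined where "joined a p \<longleftrightarrow> bij_betw p (?in a) (?out a) \<and>
      ((x, y) \<in> (col_adj E g a)\<^sup>* \<longrightarrow> (\<exists>e\<in>E. g e = a \<and> x \<in> fst e \<and> y \<in> fst e) \<or>
        (\<exists>e\<in>?in a. \<exists>u1 u2. u1 \<in> fst (p e) \<and> u2 \<in> fst (sw e) \<and> (u1, u2) \<in> ?L a))" for a p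
  have "\<exists>p. joined a p" for a
  proof (cases "(x, y) \<in> (col_adj E g a)\<^sup>* \<and> \<not> (\<exists>e\<in>E. g e = a \<and> x \<in> fst e \<and> y \<in> fst e)")
    case True
    then obtain e1 e2 u1 u2 where e: "e1 \<in> arcs" "g e1 = a" "u1 \<in> fst e1"
      "e2 \<in> arcs" "g (sw e2) = a" "u2 \<in> fst (sw e2)" "(u1, u2) \<in> ?L a"
      by (elim conjE ex_linked_arcs)
    have "finite (?in a)" "finite (?out a)" using finite_arcs by auto
    from ex_bij_betw_with_pair[OF this bal, of e2 e1] e
    obtain p where "bij_betw p (?in a) (?out a)" "p e2 = e1" by auto
    with e show ?thesis unfolding joined_def by blast
  next
    case False
    have "finite (?in a)" "finite (?out a)" using finite_arcs by auto
    from finite_same_card_bij[OF this bal] False show ?thesis unfolding joined_def by blast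
  qed
  then obtain \<pi> where \<pi>: "\<And>a. joined a (\<pi> a)" by metis
  then have bij: "\<And>a. bij_betw (\<pi> a) (?in a) (?out a)"
    and pair: "\<And>a. (x, y) \<in> (col_adj E g a)\<^sup>* \<Longrightarrow> (\<exists>e\<in>E. g e = a \<and> x \<in> fst e \<and> y \<in> fst e) \<or>
        (\<exists>e\<in>?in a. \<exists>u1 u2. u1 \<in> fst (\<pi> a e) \<and> u2 \<in> fst (sw e) \<and> (u1, u2) \<in> ?L a)"
    unfolding joined_def by blast+
  have no_y: "y \<notin> fst e" if "e \<in> E" "g e = c" "x \<in> fst e" for e
    using unlinked that by (meson col_adjI r_into_rtrancl)
  have arcs01: "e0 \<in> arcs" "e1 \<in> arcs" using e0 e1 no_y by (auto simp: arcs_def)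
  have "\<exists>J\<subseteq>arcs. {e\<in>J. g e = c} = {e0} \<and>
    (\<forall>a. card {e\<in>J. g e = a} = card {e\<in>J. g (sw e) = a}) \<and>
    (\<forall>e\<in>arcs. g (sw e) \<noteq> c \<longrightarrow> (\<pi> (g (sw e)) e \<in> J \<longleftrightarrow> e \<in> J))"
    by (rule ex_closed_trail[where t = g and h = "\<lambda>e. g (sw e)", OF finite_arcs arcs01(1) e0(2) bij])
  then obtain J where J: "J \<subseteq> arcs" and Jc: "{e\<in>J. g e = c} = {e0}"
    and Jbal: "\<forall>a. card {e\<in>J. g e = a} = card {e\<in>J. g (sw e) = a}"
    and Jpi: "\<forall>e\<in>arcs. g (sw e) \<noteq> c \<longrightarrow> (\<pi> (g (sw e)) e \<in> J \<longleftrightarrow> e \<in> J)"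
    by (elim exE conjE) (rule that)
  have sw_arcs: "sw e \<notin> J" if "e \<in> arcs" for e using that J by (auto simp: arcs_def)
  have "col_deg E (recolor J g) a v = col_deg E g a v" for a v
    using col_deg_recolor_x[OF J, of g a] col_deg_recolor_y[OF J, of g a] spec[OF Jbal, of a]
      col_deg_recolor_other[OF J, of v g a] by (cases "v = x \<or> v = y") auto
  \<comment> \<open>The trail leaves \<open>c\<close> only through \<open>e0\<close>, so
    \<open>e0\<close> is exchanged and \<open>e1\<close> is not. The new path in class
    \<open>c\<close> goes from \<open>x\<close> by \<open>e1\<close> to \<open>u1\<close>, along the
    old link to \<open>u0\<close>, and by \<open>sw e0\<close> to \<open>y\<close>.\<close>
  moreover have "(x, y) \<in> (col_adj E (recolor J g) c)\<^sup>*"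
  proof -
    have e0J: "e0 \<in> J" and e1J: "e1 \<notin> J" using Jc \<open>e0 \<noteq> e1\<close> e1(2) by auto
    have nox: "u0 \<noteq> x" "u1 \<noteq> x" using link_avoiding_notin[OF link] by auto
    have noy: "u0 \<noteq> y" using no_y e0 by blast
    \<comment> \<open>The link is given as avoiding \<open>x\<close> only; it avoids
      \<open>y\<close> as well because \<open>y\<close> lies in another component.\<close>
    have "(u0, y) \<notin> (col_adj E g c)\<^sup>*"
    proof
      assume "(u0, y) \<in> (col_adj E g c)\<^sup>*"
      with col_adjI[of e0 E g c x u0] e0 show False
        using unlinked by (meson converse_rtrancl_into_rtrancl)
    qed
    then have "(u0, u1) \<in> link_avoiding E g c ({x} \<union> {y})"
      using link by (intro link_avoiding_unreachable) auto
    then have "(u0, u1) \<in> link_avoiding E (recolor J g) c {x, y}"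
      using link_avoiding_recolor[OF J] by (auto simp: insert_commute)
    then have "(u1, u0) \<in> (col_adj E (recolor J g) c)\<^sup>*"
      by (rule link_avoiding_reach[OF link_avoiding_sym])
    moreover have "(x, u1) \<in> col_adj E (recolor J g) c"
      using e1 e1J by (intro col_adjI[of e1]) (auto simp: recolor_x[OF J])
    moreover have "(u0, y) \<in> col_adj E (recolor J g) c"
      using e0 e0J nox noy by (intro col_adjI[of "sw e0"]) (auto simp: recolor_sw[OF J])
    ultimately show ?thesis by (blast intro: reach_between)
  qed
  moreover have "(x, y) \<in> (col_adj E (recolor J g) a)\<^sup>*"
    if xy: "(x, y) \<in> (col_adj E g a)\<^sup>*" and "a \<noteq> c" for a
    using pair[OF xy]
  proof (elim disjE bexE exE conjE)
    fix e assume "e \<in> E" "g e = a" "x \<in> fst e" "y \<in> fst e"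
    then have "(x, y) \<in> col_adj E (recolor J g) a"
      by (intro col_adjI[of e]) (auto simp: recolor_common[OF J])
    then show ?thesis by (rule r_into_rtrancl)
  next
    fix e2 u1 u2
    assume e2: "e2 \<in> ?in a" and u: "u1 \<in> fst (\<pi> a e2)" "u2 \<in> fst (sw e2)" "(u1, u2) \<in> ?L a"
    let ?e1 = "\<pi> a e2"
    have e1: "?e1 \<in> arcs" "g ?e1 = a" using bspec[OF bij_betwE[OF bij[of a]] e2] by auto
    have iff: "?e1 \<in> J \<longleftrightarrow> e2 \<in> J" using bspec[OF Jpi, of e2] e2 \<open>a \<noteq> c\<close> by auto
    have nu: "u1 \<noteq> x" "u1 \<noteq> y" "u2 \<noteq> x" "u2 \<noteq> y" using link_avoiding_notin[OF u(3)] by auto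
    have "(u1, u2) \<in> link_avoiding E (recolor J g) a {x, y}"
      using u(3) link_avoiding_recolor[OF J] by auto
    then have L: "(u1, u2) \<in> (col_adj E (recolor J g) a)\<^sup>*" "(u2, u1) \<in> (col_adj E (recolor J g) a)\<^sup>*"
      by (rule link_avoiding_reach, rule link_avoiding_reach[OF link_avoiding_sym])
    show ?thesis
    proof (cases "e2 \<in> J")
      case False
      have "(x, u1) \<in> col_adj E (recolor J g) a"
        using e1 iff False u(1) sw_arcs[OF e1(1)]
        by (intro col_adjI[of ?e1]) (auto simp: recolor_def arcs_def)
      moreover have "(u2, y) \<in> col_adj E (recolor J g) a"
        using e2 False u(2) sw_arcs[of e2]
        by (intro col_adjI[of "sw e2"]) (auto simp: recolor_def arcs_def)
      ultimately show ?thesis using L(1) by (blast intro: reach_between)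
    next
      case True
      have "(x, u2) \<in> col_adj E (recolor J g) a"
        using e2 True u(2) nu
        by (intro col_adjI[of e2]) (auto simp: recolor_def arcs_def)
      moreover have "(u1, y) \<in> col_adj E (recolor J g) a"
        using e1 iff True u(1) nu
        by (intro col_adjI[of "sw ?e1"]) (auto simp: recolor_def arcs_def)
      ultimately show ?thesis using L(2) by (blast intro: reach_between)
    qed
  qed
  ultimately show ?thesis using J by (intro exI[of _ J]) blast
qed

end

section \<open>Equalizing the degrees in \<open>Z\<close>\<close>

definition exchangeable :: "('a set \<times> nat) set \<Rightarrow> 'a set \<Rightarrow> bool" where
  "exchangeable E Z \<longleftrightarrow> finite E \<and> finite Z \<and>
     (\<forall>x\<in>Z. \<forall>y\<in>Z. \<forall>e\<in>E. map_prod (image (transpose x y)) id e \<in> E)"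

lemma exchangeable_vertex_swap:
  "exchangeable E Z \<Longrightarrow> x \<in> Z \<Longrightarrow> y \<in> Z \<Longrightarrow> x \<noteq> y \<Longrightarrow> vertex_swap E x y"
  by (auto simp: exchangeable_def vertex_swap_def)

lemma sum_remove_two:
  assumes "finite Z" "x \<in> Z" "y \<in> Z" "x \<noteq> y"
  shows "(\<Sum>z\<in>Z. p z) = p x + (p y + (\<Sum>z\<in>Z - {x} - {y}. p z))"
  using assms sum.remove[of Z x p] sum.remove[of "Z - {x}" y p] by simp

text \<open>Moving one unit from \<open>x\<close> to \<open>y\<close> changes the sum of squares by
  \<open>2 * d y - 2 * d x + 2\<close>, written here without subtraction. The sum falls across a gap
  of at least two and does not grow across a gap of one.\<close>

lemma sum_squares_transfer:
  fixes d d' :: "'a \<Rightarrow> nat"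
  assumes "finite Z" "x \<in> Z" "y \<in> Z" "x \<noteq> y" "d' x + 1 = d x" "d' y = d y + 1"
    and "\<And>z. z \<noteq> x \<Longrightarrow> z \<noteq> y \<Longrightarrow> d' z = d z"
  shows "(\<Sum>z\<in>Z. (d' z)\<^sup>2) + 2 * d x = (\<Sum>z\<in>Z. (d z)\<^sup>2) + 2 * d y + 2"
proof -
  note sum_remove_two[OF assms(1-4), of "\<lambda>z. (d z)\<^sup>2"]
    sum_remove_two[OF assms(1-4), of "\<lambda>z. (d' z)\<^sup>2"]
  moreover have "(\<Sum>z\<in>Z - {x} - {y}. (d' z)\<^sup>2) = (\<Sum>z\<in>Z - {x} - {y}. (d z)\<^sup>2)"
    using assms(7) by (intro sum.cong) auto
  moreover have "(d x)\<^sup>2 = (d' x)\<^sup>2 + 2 * d' x + 1" "(d' y)\<^sup>2 = (d y)\<^sup>2 + 2 * d y + 1"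
    unfolding assms(5)[symmetric] assms(6) by (simp_all add: power2_eq_square)
  ultimately show ?thesis using assms(5) by simp
qed

text \<open>The gap in class \<open>c\<close> is a surplus of arcs leaving \<open>c\<close>, hence
  there is a trail to a colour \<open>d\<close> in which \<open>y\<close> has the larger degree. In
  \<open>c\<close> a unit moves across a gap of at least two, in \<open>d\<close> it moves back
  across a gap of at least one, so the total of squares falls.\<close>

lemma ex_balancing_step:
  assumes ex: "exchangeable E Z" and C: "finite C" "g ` E \<subseteq> C"
    and xy: "x \<in> Z" "y \<in> Z" and lt: "col_deg E g c y + 1 < col_deg E g c x"
  shows "\<exists>g'. g' ` E \<subseteq> C \<and> (\<forall>e\<in>E. fst e \<inter> Z = {} \<longrightarrow> g' e = g e) \<and>
    (\<forall>a v. v \<notin> Z \<longrightarrow> col_deg E g' a v = col_deg E g a v) \<and>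
    (\<forall>a. (\<Sum>z\<in>Z. col_deg E g' a z) = (\<Sum>z\<in>Z. col_deg E g a z)) \<and>
    (\<Sum>a\<in>C. \<Sum>z\<in>Z. (col_deg E g' a z)\<^sup>2) < (\<Sum>a\<in>C. \<Sum>z\<in>Z. (col_deg E g a z)\<^sup>2)"
proof -
  have "x \<noteq> y" using lt by auto
  with ex xy interpret vertex_swap E x y by (intro exchangeable_vertex_swap)
  have finZ: "finite Z" using ex by (simp add: exchangeable_def)
  have "card {e\<in>arcs. g (sw e) = c} < card {e\<in>arcs. g e = c}" using balance[of g c] lt by simp
  from ex_trail_to_deficit[OF finite_arcs this] obtain J d where J: "J \<subseteq> arcs"
    and d: "card {e\<in>arcs. g e = d} < card {e\<in>arcs. g (sw e) = d}"
    and Jbal: "\<And>a. card {e\<in>J. g e = a} + (if a = d then 1 else 0) =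
         card {e\<in>J. g (sw e) = a} + (if a = c then 1 else 0)" by blast
  let ?g = "recolor J g"
  have ltd: "col_deg E g d x < col_deg E g d y" using balance[of g d] d by simp
  with lt have "c \<noteq> d" by auto
  have "d \<in> C"
  proof -
    have "{e\<in>arcs. g (sw e) = d} \<noteq> {}" using d by (intro notI) simp
    with arcs_subset C show ?thesis by fastforce
  qed
  have "c \<in> C"
  proof -
    have "{e\<in>E. g e = c \<and> x \<in> fst e} \<noteq> {}" using lt unfolding col_deg_def by (intro notI) simp
    with C show ?thesis by auto
  qed
  note dx = col_deg_recolor_x[OF J, of g] and dy = col_deg_recolor_y[OF J, of g]
    and other = col_deg_recolor_other[OF J, of _ g]
  have cx: "col_deg E ?g c x + 1 = col_deg E g c x" "col_deg E ?g c y = col_deg E g c y + 1"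
    using dx[of c] dy[of c] Jbal[of c] \<open>c \<noteq> d\<close> by simp_all
  have dx': "col_deg E ?g d x = col_deg E g d x + 1" "col_deg E ?g d y + 1 = col_deg E g d y"
    using dx[of d] dy[of d] Jbal[of d] \<open>c \<noteq> d\<close> by simp_all
  have same: "col_deg E ?g a v = col_deg E g a v" if "a \<noteq> c" "a \<noteq> d" for a v
    using dx[of a] dy[of a] Jbal[of a] other[of v a] that by (cases "v = x \<or> v = y") auto
  have sumxy: "col_deg E ?g a x + col_deg E ?g a y = col_deg E g a x + col_deg E g a y" for a
    using dx[of a] dy[of a] by simp
  have sums: "(\<Sum>z\<in>Z. col_deg E ?g a z) = (\<Sum>z\<in>Z. col_deg E g a z)" for a
  proof -
    have "(\<Sum>z\<in>Z - {x} - {y}. col_deg E ?g a z) = (\<Sum>z\<in>Z - {x} - {y}. col_deg E g a z)"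
      using other by (intro sum.cong) auto
    then show ?thesis
      using sumxy[of a] sum_remove_two[OF finZ xy \<open>x \<noteq> y\<close>, of "col_deg E g a"]
        sum_remove_two[OF finZ xy \<open>x \<noteq> y\<close>, of "col_deg E ?g a"] by simp
  qed
  have less_c: "(\<Sum>z\<in>Z. (col_deg E ?g c z)\<^sup>2) < (\<Sum>z\<in>Z. (col_deg E g c z)\<^sup>2)"
    using sum_squares_transfer[of Z x y "col_deg E ?g c" "col_deg E g c"] cx lt other finZ xy \<open>x \<noteq> y\<close>
    by simp
  have le_d: "(\<Sum>z\<in>Z. (col_deg E ?g d z)\<^sup>2) \<le> (\<Sum>z\<in>Z. (col_deg E g d z)\<^sup>2)"
    using sum_squares_transfer[of Z y x "col_deg E ?g d" "col_deg E g d"] dx' ltd other finZ xy \<open>x \<noteq> y\<close>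
    by simp
  have "(\<Sum>z\<in>Z. (col_deg E ?g a z)\<^sup>2) \<le> (\<Sum>z\<in>Z. (col_deg E g a z)\<^sup>2)" for a
  proof (cases "a = c \<or> a = d")
    case True
    then show ?thesis using less_c le_d by auto
  next
    case False
    then show ?thesis using same[of a] by simp
  qed
  then have "(\<Sum>a\<in>C. \<Sum>z\<in>Z. (col_deg E ?g a z)\<^sup>2) < (\<Sum>a\<in>C. \<Sum>z\<in>Z. (col_deg E g a z)\<^sup>2)"
    using less_c \<open>c \<in> C\<close> C(1) by (intro sum_strict_mono_ex1) blast+
  moreover have "?g e = g e" if "fst e \<inter> Z = {}" for e
    using that xy by (intro recolor_untouched[OF J]) auto
  moreover have "col_deg E ?g a v = col_deg E g a v" if "v \<notin> Z" for a v
    using that xy by (intro other) auto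
  ultimately show ?thesis using recolor_image[OF J C(2)] sums by (intro exI[of _ ?g]) blast
qed

text \<open>Descent on the sum of squared degrees. The average is \<open>r\<close>, so an unbalanced
  class has a vertex of \<open>Z\<close> above \<open>r\<close> and one below, hence a gap of at
  least two.\<close>

lemma ex_balanced_coloring:
  assumes ex: "exchangeable E Z" and C: "finite C" "g ` E \<subseteq> C"
    and sum: "\<And>c. c \<in> C \<Longrightarrow> (\<Sum>z\<in>Z. col_deg E g c z) = r * card Z"
  shows "\<exists>g'. g' ` E \<subseteq> C \<and> (\<forall>e\<in>E. fst e \<inter> Z = {} \<longrightarrow> g' e = g e) \<and>
    (\<forall>a v. v \<notin> Z \<longrightarrow> col_deg E g' a v = col_deg E g a v) \<and>
    (\<forall>c\<in>C. \<forall>z\<in>Z. col_deg E g' c z = r)"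
  using C(2) sum
proof (induction "\<Sum>a\<in>C. \<Sum>z\<in>Z. (col_deg E g a z)\<^sup>2" arbitrary: g rule: less_induct)
  case less
  have finZ: "finite Z" using ex by (simp add: exchangeable_def)
  show ?case
  proof (cases "\<forall>c\<in>C. \<forall>z\<in>Z. col_deg E g c z = r")
    case True
    with less.prems show ?thesis by blast
  next
    case False
    then obtain c z where c: "c \<in> C" "z \<in> Z" "col_deg E g c z \<noteq> r" by blast
    have sum': "(\<Sum>z\<in>Z. col_deg E g c z) = (\<Sum>z\<in>Z. r)" using less.prems(2)[OF c(1)] by simp
    have "\<exists>x\<in>Z. r < col_deg E g c x"
    proof (rule ccontr)
      assume "\<not> ?thesis"
      with c finZ have "(\<Sum>z\<in>Z. col_deg E g c z) < (\<Sum>z\<in>Z. r)"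
        by (intro sum_strict_mono_ex1) (auto simp: not_less intro!: bexI[of _ z])
      with sum' show False by simp
    qed
    moreover have "\<exists>y\<in>Z. col_deg E g c y < r"
    proof (rule ccontr)
      assume "\<not> ?thesis"
      with c finZ have "(\<Sum>z\<in>Z. r) < (\<Sum>z\<in>Z. col_deg E g c z)"
        by (intro sum_strict_mono_ex1) (auto simp: not_less intro!: bexI[of _ z])
      with sum' show False by simp
    qed
    ultimately obtain x y where xy: "x \<in> Z" "y \<in> Z" "col_deg E g c y + 1 < col_deg E g c x"
      by force
    from ex_balancing_step[OF ex C(1) less.prems(1) xy] obtain g' where g':
      "g' ` E \<subseteq> C" "\<forall>e\<in>E. fst e \<inter> Z = {} \<longrightarrow> g' e = g e"
      "\<forall>a v. v \<notin> Z \<longrightarrow> col_deg E g' a v = col_deg E g a v"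
      "\<forall>a. (\<Sum>z\<in>Z. col_deg E g' a z) = (\<Sum>z\<in>Z. col_deg E g a z)"
      "(\<Sum>a\<in>C. \<Sum>z\<in>Z. (col_deg E g' a z)\<^sup>2) < (\<Sum>a\<in>C. \<Sum>z\<in>Z. (col_deg E g a z)\<^sup>2)" by blast
    from less.hyps[OF g'(5,1)] g'(4) less.prems(2) obtain g'' where g'':
      "g'' ` E \<subseteq> C" "\<forall>e\<in>E. fst e \<inter> Z = {} \<longrightarrow> g'' e = g' e"
      "\<forall>a v. v \<notin> Z \<longrightarrow> col_deg E g'' a v = col_deg E g' a v"
      "\<forall>c\<in>C. \<forall>z\<in>Z. col_deg E g'' c z = r" by auto
    with g'(2,3) show ?thesis by (intro exI[of _ g'']) simp
  qed
qed

section \<open>Connecting the colour classes\<close>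

text \<open>Cut the walk at its last visit to \<open>x\<close> or \<open>x'\<close>; the first
  alternative is the case of no such visit.\<close>

lemma last_visit:
  assumes "(v, z) \<in> (col_adj E g c)\<^sup>*" "x \<noteq> x'"
  shows "(v, z) \<in> link_avoiding E g c {x, x'} \<or> (x, z) \<in> link_avoiding E g c {x'} \<or>
    (x', z) \<in> link_avoiding E g c {x}"
  using assms(1)
proof (induction rule: converse_rtrancl_induct)
  case base
  show ?case using assms(2) link_avoiding_refl[of z _ E g c]
    by (cases "z = x"; cases "z = x'") auto
next
  case (step v w)
  have "(v, z) \<in> link_avoiding E g c {x, x'}"
    if "(w, z) \<in> link_avoiding E g c {x, x'}" "v \<noteq> x" "v \<noteq> x'"
    using that by (intro link_avoiding_step[OF step.hyps(1)]) auto
  moreover have "(x, z) \<in> link_avoiding E g c {x'}"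
    if "(w, z) \<in> link_avoiding E g c {x, x'}" "v = x"
  proof -
    have "(w, z) \<in> link_avoiding E g c {x'}" by (rule link_avoiding_antimono[OF _ that(1)]) auto
    with that assms(2) show ?thesis using link_avoiding_step[OF step.hyps(1)] by auto
  qed
  moreover have "(x', z) \<in> link_avoiding E g c {x}"
    if "(w, z) \<in> link_avoiding E g c {x, x'}" "v = x'"
  proof -
    have "(w, z) \<in> link_avoiding E g c {x}" by (rule link_avoiding_antimono[OF _ that(1)]) auto
    with that assms(2) show ?thesis using link_avoiding_step[OF step.hyps(1)] by auto
  qed
  ultimately show ?case using step.IH by blast
qed

text \<open>If there is no such \<open>x\<close>, root every component at a vertex of \<open>Z\<close>, and call an incidence \<open>(e, x)\<close> with
  \<open>x \<in> Z\<close> a child if \<open>e\<close> is not linked to the root outside \<open>x\<close>. Every \<open>x\<close> has at most one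
  non-child incidence, and a root has none, so there are at least \<open>(r - 1) * card Z + 1\<close> children.
  On the other hand, no edge and no vertex of \<open>W\<close> lies below two children.\<close>

lemma ex_cyclic_vertex:
  assumes fin: "finite E" "finite W" "finite Z" and disj: "W \<inter> Z = {}"
    and E: "\<And>e. e \<in> E \<Longrightarrow> fst e \<subseteq> W \<union> Z \<and> card (fst e) = 3"
    and deg: "\<And>z. z \<in> Z \<Longrightarrow> col_deg E g c z = r" and r: "r \<ge> 2"
    and size: "2 * card W \<le> card Z" "Z \<noteq> {}"
  obtains x e0 e1 u0 u1 where "x \<in> Z" "e0 \<in> E" "g e0 = c" "x \<in> fst e0" "u0 \<in> fst e0"
    "e1 \<in> E" "g e1 = c" "x \<in> fst e1" "u1 \<in> fst e1" "e0 \<noteq> e1" "(u0, u1) \<in> link_avoiding E g c {x}"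
proof (rule ccontr)
  assume "\<not> thesis"
  note that_thesis = that
  let ?L = "link_avoiding E g c" and ?R = "(col_adj E g c)\<^sup>*"
  define F where "F = {e\<in>E. g e = c}"
  \<comment> \<open>The denied conclusion: edges of the class at \<open>x\<close> that are linked
    outside \<open>x\<close> coincide.\<close>
  have acyclic: "e0 = e1"
    if "x \<in> Z" "e0 \<in> F" "x \<in> fst e0" "u0 \<in> fst e0" "e1 \<in> F" "x \<in> fst e1" "u1 \<in> fst e1"
      "(u0, u1) \<in> ?L {x}" for x e0 e1 u0 u1
    using that \<open>\<not> thesis\<close> that_thesis[of x e0 u0 e1 u1] unfolding F_def by blast
  have adj: "(u, v) \<in> col_adj E g c" if "e \<in> F" "u \<in> fst e" "v \<in> fst e" for e u v
    using that by (auto simp: F_def intro: col_adjI)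
  \<comment> \<open>The choice is made by a property shared by all vertices of a component, so each
    component has a single root.\<close>
  define root where "root x = (SOME z. z \<in> Z \<and> (z, x) \<in> ?R)" for x
  have root: "root x \<in> Z" "(root x, x) \<in> ?R" if "x \<in> Z" for x
    using someI[of "\<lambda>z. z \<in> Z \<and> (z, x) \<in> ?R" x] that by (auto simp: root_def)
  have root_eq: "root x = root x'" if "(x, x') \<in> ?R" for x x'
  proof -
    have "(z, x) \<in> ?R \<longleftrightarrow> (z, x') \<in> ?R" for z
      using rtrancl_trans[OF _ that] rtrancl_trans[OF _ col_reach_sym[OF that]] by blast
    then show ?thesis by (simp add: root_def)
  qed
  \<comment> \<open>At the root itself every incidence is a child, as no link outside
    \<open>x\<close> ends in \<open>x\<close>.\<close>
  define child where "child e x \<longleftrightarrow> (\<forall>w\<in>fst e - {x}. (w, root x) \<notin> ?L {x})"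
    for e :: "'a set \<times> nat" and x
  define Q where "Q = (SIGMA e:F. fst e \<inter> Z)"
  define P where "P = {p\<in>Q. child (fst p) (snd p)}"
  define D where "D = {e\<in>F. fst e \<inter> W = {}}"
  define Q1 where "Q1 = (SIGMA e:D. fst e \<inter> Z)"
  have finF: "finite F" using fin by (simp add: F_def)
  have finQ: "finite Q" using finF fin by (simp add: Q_def)
  have "card Q = (\<Sum>z\<in>Z. col_deg E g c z)"
    using fin finF by (simp add: Q_def F_def sum_col_deg)
  then have cQ: "card Q = r * card Z" using deg by simp
  have "card (fst e \<inter> Z) = 3" if "e \<in> D" for e
  proof -
    have "fst e \<inter> Z = fst e" using that E[of e] by (auto simp: D_def F_def)
    then show ?thesis using that E[of e] by (simp add: D_def F_def)
  qed
  moreover have finD: "finite D" using finF by (simp add: D_def)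
  ultimately have cQ1: "card Q1 = 3 * card D" using fin by (simp add: Q1_def)
  have Q1Q: "Q1 \<subseteq> Q" by (auto simp: Q1_def Q_def D_def)
  \<comment> \<open>By the last visit on a walk to the common root, one of \<open>x\<close>,
    \<open>x'\<close> reaches the root outside the other. Through the shared edge or the shared
    \<open>w\<close> this links the other vertex's edge to the root, so the other incidence is not a
    child.\<close>
  have no_two: False
    if p: "(e, x) \<in> P" "(e', x') \<in> P" "x \<noteq> x'" and touch: "e = e' \<or> (\<exists>w\<in>W. w \<in> fst e \<and> w \<in> fst e')"
    for e x e' x'
  proof -
    have e: "e \<in> F" "x \<in> fst e" "x \<in> Z" "child e x" "e' \<in> F" "x' \<in> fst e'" "x' \<in> Z" "child e' x'"
      using p by (auto simp: P_def Q_def)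
    have "(x, x') \<in> ?R"
      using touch
    proof
      assume "e = e'"
      with adj[OF e(1,2), of x'] e(6) show ?thesis by auto
    next
      assume "\<exists>w\<in>W. w \<in> fst e \<and> w \<in> fst e'"
      then obtain w where "w \<in> fst e" "w \<in> fst e'" by blast
      from adj[OF e(1,2) this(1)] adj[OF e(5) this(2) e(6)] show ?thesis by simp
    qed
    then have rr: "root x' = root x" using root_eq by simp
    have sub: False if "(x, root x) \<in> ?L {x'}" "e \<in> F" "x \<in> fst e" "x \<in> Z" "x' \<in> Z" "child e' x'"
      "e = e' \<or> (\<exists>w\<in>W. w \<in> fst e \<and> w \<in> fst e')" "root x' = root x" "x \<noteq> x'" for e x e' x'
      using that(7)
    proof
      assume "e = e'"
      with that show False by (auto simp: child_def)
    next
      assume "\<exists>w\<in>W. w \<in> fst e \<and> w \<in> fst e'"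
      then obtain w where w: "w \<in> W" "w \<in> fst e" "w \<in> fst e'" by blast
      with that disj have "w \<noteq> x'" by auto
      then have "(w, root x) \<in> ?L {x'}"
        using link_avoiding_step[OF adj[OF that(2) w(2) that(3)] _ that(1)] by simp
      with that w \<open>w \<noteq> x'\<close> show False by (auto simp: child_def)
    qed
    have "(x, root x) \<in> ?R" using root(2)[OF e(3)] by (rule col_reach_sym)
    from last_visit[OF this p(3)] consider "(x, root x) \<in> ?L {x'}" | "(x', root x) \<in> ?L {x}"
      by (auto dest: link_avoiding_notin)
    then show False
    proof cases
      case 1
      from sub[OF this e(1-3,7,8) touch rr p(3)] show False .
    next
      case 2
      then have "(x', root x') \<in> ?L {x}" using rr by simp
      from sub[OF this e(5-7) e(3,4)] show False using touch rr p(3) by auto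
    qed
  qed
  obtain z0 where "z0 \<in> Z" using size by auto
  define x0 where "x0 = root z0"
  have x0: "x0 \<in> Z" "root x0 = x0"
    using root[OF \<open>z0 \<in> Z\<close>] root_eq[of x0 z0] by (auto simp: x0_def)
  \<comment> \<open>The edges of two non-child incidences at \<open>x\<close> are linked to each
    other through the root, hence equal by \<open>acyclic\<close>.\<close>
  have nonchild: "card (Q - P) \<le> card (Z - {x0})"
  proof (rule card_inj_on_le[where f = snd])
    show "snd ` (Q - P) \<subseteq> Z - {x0}"
    proof (clarsimp, intro conjI)
      fix S i x assume p: "((S, i), x) \<in> Q" "((S, i), x) \<notin> P"
      then show "x \<in> Z" by (auto simp: Q_def)
      from p obtain w where "(w, root x) \<in> ?L {x}" by (auto simp: P_def child_def)
      then show "x \<noteq> x0" using x0 by (auto dest: link_avoiding_notin)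
    qed
    show "inj_on snd (Q - P)"
    proof (rule inj_onI, clarsimp)
      fix S i S' i' x
      assume p: "((S, i), x) \<in> Q" "((S, i), x) \<notin> P" "((S', i'), x) \<in> Q" "((S', i'), x) \<notin> P"
      then obtain w w' where w: "w \<in> S" "(w, root x) \<in> ?L {x}" "w' \<in> S'" "(w', root x) \<in> ?L {x}"
        by (auto simp: P_def child_def)
      have "(w, w') \<in> ?L {x}" using link_avoiding_trans[OF w(2) link_avoiding_sym[OF w(4)]] .
      with p w acyclic[of x "(S, i)" w "(S', i')" w'] show "S = S' \<and> i = i'"
        by (auto simp: Q_def)
    qed
  qed (use fin in simp)
  have "card (P \<inter> Q1) \<le> card D"
  proof (rule card_inj_on_le[where f = fst])
    show "inj_on fst (P \<inter> Q1)"
    proof (rule inj_onI, clarsimp)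
      fix S i x x' assume "((S, i), x) \<in> P" "((S, i), x') \<in> P"
      then show "x = x'" using no_two[of "(S, i)" x "(S, i)" x'] by blast
    qed
  qed (use finD in \<open>auto simp: Q1_def\<close>)
  \<comment> \<open>Send a child whose edge meets \<open>W\<close> to a vertex of \<open>W\<close>
    on that edge. Equal images give equal \<open>x\<close> by \<open>no_two\<close>, and then equal
    edges by \<open>acyclic\<close> with the trivial link.\<close>
  moreover have "card (P - Q1) \<le> card W"
  proof -
    define f where "f p = (SOME w. w \<in> W \<and> w \<in> fst (fst p))" for p :: "('a set \<times> nat) \<times> 'a"
    have f: "f p \<in> W \<and> f p \<in> fst (fst p)" if "p \<in> P - Q1" for p
      unfolding f_def by (rule someI_ex) (use that in \<open>auto simp: P_def Q_def Q1_def D_def\<close>)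
    show ?thesis
    proof (rule card_inj_on_le[where f = f])
      show "inj_on f (P - Q1)"
      proof (rule inj_onI)
        fix p p' assume p: "p \<in> P - Q1" "p' \<in> P - Q1" "f p = f p'"
        obtain e x e' x' where pe: "p = (e, x)" "p' = (e', x')" by (cases p, cases p') blast
        have w: "f p \<in> W" "f p \<in> fst e" "f p \<in> fst e'" using f[OF p(1)] f[OF p(2)] p(3) pe by auto
        have "x = x'" using no_two[of e x e' x'] p w pe by auto
        have e: "e \<in> F" "x \<in> fst e" "x \<in> Z" "e' \<in> F" "x \<in> fst e'"
          using p pe \<open>x = x'\<close> by (auto simp: P_def Q_def)
        then have "(f p, f p) \<in> ?L {x}" using w(1) disj by (intro link_avoiding_refl) auto
        then have "e = e'" using acyclic[OF e(3,1,2) w(2) e(4,5) w(3)] by simp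
        with \<open>x = x'\<close> show "p = p'" using pe by simp
      qed
    qed (use f fin in auto)
  qed
  moreover have "card (P - Q1) \<le> card (Q - Q1)"
    using finQ by (intro card_mono) (auto simp: P_def)
  moreover have "card (Q - Q1) + card Q1 = card Q"
    using card_Diff_subset[OF finite_subset[OF Q1Q finQ] Q1Q] card_mono[OF finQ Q1Q] by simp
  moreover have "card P = card (P \<inter> Q1) + card (P - Q1)"
    using finQ by (intro card_Int_Diff) (auto simp: P_def)
  moreover have "card Q = card (Q - P) + card P"
  proof -
    have "P \<subseteq> Q" by (auto simp: P_def)
    then show ?thesis using card_Diff_subset[OF finite_subset[OF _ finQ], of P] card_mono[OF finQ, of P] by simp
  qed
  moreover have "card (Z - {x0}) + 1 = card Z" using card.remove[OF fin(3) x0(1)] by linarith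
  moreover have "2 * card Z \<le> r * card Z" using r by (rule mult_right_mono) simp
  \<comment> \<open>In \<open>card P \<le> card D + card (P - Q1)\<close>, taken three times, bound
    the last term once by \<open>r * card Z - 3 * card D\<close> and twice by \<open>card W\<close>.
    This gives \<open>3 * card P \<le> r * card Z + 2 * card W \<le> (r + 1) * card Z\<close>,
    against \<open>card P > (r - 1) * card Z\<close> and \<open>r \<ge> 2\<close>.\<close>
  ultimately show False using cQ cQ1 nonchild size by linarith
qed

section \<open>Merging until every class is connected\<close>

definition regular_extension ::
    "('a set \<times> nat) set \<Rightarrow> nat set \<Rightarrow> nat \<Rightarrow> 'a set \<Rightarrow> 'a set \<Rightarrow> ('a set \<times> nat \<Rightarrow> nat) \<Rightarrow>
      ('a set \<times> nat \<Rightarrow> nat) \<Rightarrow> bool" where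
  "regular_extension E C r W Z f g \<longleftrightarrow> g ` E \<subseteq> C \<and> (\<forall>e\<in>E. fst e \<inter> Z = {} \<longrightarrow> g e = f e) \<and>
     (\<forall>c\<in>C. \<forall>v\<in>W \<union> Z. col_deg E g c v = r)"

definition col_connected ::
    "('a set \<times> nat) set \<Rightarrow> ('a set \<times> nat \<Rightarrow> nat) \<Rightarrow> nat \<Rightarrow> 'a set \<Rightarrow> bool" where
  "col_connected E g c V \<longleftrightarrow> V \<times> V \<subseteq> (col_adj E g c)\<^sup>*"

context
  fixes E :: "('a set \<times> nat) set" and C :: "nat set" and r :: nat and W Z :: "'a set"
    and f :: "'a set \<times> nat \<Rightarrow> nat"
  assumes ex: "exchangeable E Z" and finW: "finite W" and disj: "W \<inter> Z = {}"
    and E: "\<And>e. e \<in> E \<Longrightarrow> fst e \<subseteq> W \<union> Z \<and> card (fst e) = 3"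
    and r: "r \<ge> 2" and size: "2 * card W \<le> card Z" "Z \<noteq> {}"
    and escape: "\<And>g c w. regular_extension E C r W Z f g \<Longrightarrow> c \<in> C \<Longrightarrow> w \<in> W \<Longrightarrow>
      \<exists>z\<in>Z. (w, z) \<in> (col_adj E g c)\<^sup>*"
begin

text \<open>The cyclic vertex gives \<open>x\<close>; a component missing \<open>x\<close> contains
  some \<open>y\<close> in \<open>Z\<close> by \<open>escape\<close>, which is assumed for all
  regular extensions because the colouring keeps changing. A class that is already connected joins
  \<open>x\<close> to \<open>y\<close> and so stays connected, while class \<open>c\<close> gains
  the pair \<open>(x, y)\<close>.\<close>

lemma ex_merging_step:
  assumes g: "regular_extension E C r W Z f g" and c: "c \<in> C"
    and disconnected: "\<not> col_connected E g c (W \<union> Z)"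
  shows "\<exists>g'. regular_extension E C r W Z f g' \<and>
    (\<forall>a. col_connected E g a (W \<union> Z) \<longrightarrow> col_connected E g' a (W \<union> Z)) \<and>
    card ((W \<union> Z) \<times> (W \<union> Z) \<inter> (col_adj E g c)\<^sup>*) < card ((W \<union> Z) \<times> (W \<union> Z) \<inter> (col_adj E g' c)\<^sup>*)"
proof -
  let ?V = "W \<union> Z"
  have fin: "finite E" "finite Z" using ex by (auto simp: exchangeable_def)
  have degZ: "\<And>z. z \<in> Z \<Longrightarrow> col_deg E g c z = r" using g c by (auto simp: regular_extension_def)
  obtain x e0 e1 u0 u1 where x: "x \<in> Z" and e: "e0 \<in> E" "g e0 = c" "x \<in> fst e0" "u0 \<in> fst e0"
    "e1 \<in> E" "g e1 = c" "x \<in> fst e1" "u1 \<in> fst e1" "e0 \<noteq> e1" "(u0, u1) \<in> link_avoiding E g c {x}"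
    by (rule ex_cyclic_vertex[OF fin(1) finW fin(2) disj E degZ r size])
  have "\<exists>v\<in>?V. (x, v) \<notin> (col_adj E g c)\<^sup>*"
  proof (rule ccontr)
    assume "\<not> ?thesis"
    then have all: "\<And>v. v \<in> ?V \<Longrightarrow> (x, v) \<in> (col_adj E g c)\<^sup>*" by blast
    have "(u, v) \<in> (col_adj E g c)\<^sup>*" if "u \<in> ?V" "v \<in> ?V" for u v
      using col_reach_sym[OF all[OF that(1)]] all[OF that(2)] by (rule rtrancl_trans)
    with disconnected show False by (auto simp: col_connected_def)
  qed
  then obtain v where v: "v \<in> ?V" "(x, v) \<notin> (col_adj E g c)\<^sup>*" by blast
  then obtain y where y: "y \<in> Z" "(v, y) \<in> (col_adj E g c)\<^sup>*"
    using escape[OF g c, of v] by (cases "v \<in> W") auto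
  have unlinked: "(x, y) \<notin> (col_adj E g c)\<^sup>*"
    using v(2) rtrancl_trans[OF _ col_reach_sym[OF y(2)]] by blast
  then have "x \<noteq> y" by auto
  with ex x y interpret vertex_swap E x y by (intro exchangeable_vertex_swap)
  \<comment> \<open>Outside \<open>C\<close> both degrees are zero, as no edge has such a
    colour.\<close>
  have deg: "col_deg E g a x = col_deg E g a y" for a
  proof (cases "a \<in> C")
    case True
    with g x y show ?thesis by (auto simp: regular_extension_def)
  next
    case False
    then have "{e\<in>E. g e = a \<and> u \<in> fst e} = {}" for u using g by (auto simp: regular_extension_def)
    then show ?thesis by (simp only: col_deg_def)
  qed
  from ex_merging_recoloring[OF deg unlinked e] obtain J where J: "J \<subseteq> arcs"
    and same: "\<And>a v. col_deg E (recolor J g) a v = col_deg E g a v"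
    and keep: "\<And>a. a = c \<or> (x, y) \<in> (col_adj E g a)\<^sup>* \<Longrightarrow> (x, y) \<in> (col_adj E (recolor J g) a)\<^sup>*"
    by blast
  have mono: "(col_adj E g a)\<^sup>* \<subseteq> (col_adj E (recolor J g) a)\<^sup>*"
    if "a = c \<or> (x, y) \<in> (col_adj E g a)\<^sup>*" for a
    using reach_recolor_mono[OF J keep[OF that]] .
  have "regular_extension E C r W Z f (recolor J g)"
    unfolding regular_extension_def
  proof (intro conjI ballI impI)
    show "recolor J g ` E \<subseteq> C"
      using g by (intro recolor_image[OF J]) (auto simp: regular_extension_def)
  next
    fix e assume "e \<in> E" "fst e \<inter> Z = {}"
    with x y g show "recolor J g e = f e"
      by (subst recolor_untouched[OF J]) (auto simp: regular_extension_def)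
  next
    fix a v assume "a \<in> C" "v \<in> W \<union> Z"
    with g show "col_deg E (recolor J g) a v = r" by (simp add: same regular_extension_def)
  qed
  moreover have "col_connected E (recolor J g) a ?V" if "col_connected E g a ?V" for a
  proof -
    have "(x, y) \<in> (col_adj E g a)\<^sup>*" using that x y by (auto simp: col_connected_def)
    with mono[of a] that show ?thesis by (auto simp: col_connected_def)
  qed
  moreover have "card (?V \<times> ?V \<inter> (col_adj E g c)\<^sup>*) < card (?V \<times> ?V \<inter> (col_adj E (recolor J g) c)\<^sup>*)"
  proof (rule psubset_card_mono)
    have "(x, y) \<in> ?V \<times> ?V" using x y by auto
    then show "?V \<times> ?V \<inter> (col_adj E g c)\<^sup>* \<subset> ?V \<times> ?V \<inter> (col_adj E (recolor J g) c)\<^sup>*"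
      using mono[of c] keep[of c] unlinked by auto
  qed (use finW fin in simp)
  ultimately show ?thesis by blast
qed

lemma ex_one_more_connected:
  assumes "regular_extension E C r W Z f g" "c \<in> C"
  shows "\<exists>g'. regular_extension E C r W Z f g' \<and> col_connected E g' c (W \<union> Z) \<and>
    (\<forall>a. col_connected E g a (W \<union> Z) \<longrightarrow> col_connected E g' a (W \<union> Z))"
  using assms(1)
proof (induction "card ((W \<union> Z) \<times> (W \<union> Z)) - card ((W \<union> Z) \<times> (W \<union> Z) \<inter> (col_adj E g c)\<^sup>*)"
    arbitrary: g rule: less_induct)
  case less
  let ?V = "W \<union> Z"
  show ?case
  proof (cases "col_connected E g c ?V")
    case True
    with less.prems show ?thesis by blast
  next
    case False
    from ex_merging_step[OF less.prems assms(2) this] obtain g' where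
      g': "regular_extension E C r W Z f g'"
        "\<And>a. col_connected E g a ?V \<Longrightarrow> col_connected E g' a ?V"
        "card (?V \<times> ?V \<inter> (col_adj E g c)\<^sup>*) < card (?V \<times> ?V \<inter> (col_adj E g' c)\<^sup>*)" by blast
    have "finite (?V \<times> ?V)" using ex finW by (simp add: exchangeable_def)
    then have "card (?V \<times> ?V \<inter> (col_adj E g' c)\<^sup>*) \<le> card (?V \<times> ?V)" by (intro card_mono) auto
    with g'(3) have "card (?V \<times> ?V) - card (?V \<times> ?V \<inter> (col_adj E g' c)\<^sup>*) <
      card (?V \<times> ?V) - card (?V \<times> ?V \<inter> (col_adj E g c)\<^sup>*)" by linarith
    from less.hyps[OF this g'(1)] g'(2) show ?thesis by blast
  qed
qed

lemma ex_all_connected: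
  assumes "regular_extension E C r W Z f g" "finite C"
  shows "\<exists>g'. regular_extension E C r W Z f g' \<and> (\<forall>c\<in>C. col_connected E g' c (W \<union> Z))"
proof -
  have "\<exists>g'. regular_extension E C r W Z f g' \<and> (\<forall>c\<in>A. col_connected E g' c (W \<union> Z))"
    if "finite A" "A \<subseteq> C" for A
    using that
  proof (induction rule: finite_induct)
    case empty
    with assms(1) show ?case by blast
  next
    case (insert c A)
    then obtain g1 where g1: "regular_extension E C r W Z f g1"
      "\<forall>c\<in>A. col_connected E g1 c (W \<union> Z)" by auto
    from ex_one_more_connected[OF g1(1), of c] insert.prems g1(2) show ?case by blast
  qed
  with assms(2) show ?thesis by blast
qed

end

section \<open>Colourings with prescribed degrees\<close>

lemma col_deg_cong: "(\<And>e. e \<in> A \<Longrightarrow> g e = g' e) \<Longrightarrow> col_deg A g c v = col_deg A g' c v"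
  unfolding col_deg_def by (intro arg_cong[of _ _ card]) auto

lemma col_deg_Un:
  assumes "finite A" "finite B" "A \<inter> B = {}"
  shows "col_deg (A \<union> B) g c v = col_deg A g c v + col_deg B g c v"
proof -
  have "{e\<in>A \<union> B. g e = c \<and> v \<in> fst e} =
    {e\<in>A. g e = c \<and> v \<in> fst e} \<union> {e\<in>B. g e = c \<and> v \<in> fst e}" by auto
  then show ?thesis using assms unfolding col_deg_def
    by (simp only:) (intro card_Un_disjoint; auto)
qed

text \<open>Colour the edges of \<open>F - A\<close> one at a time. If every colour is blocked for
  \<open>e\<close>, each occurs on at least \<open>r\<close> edges meeting
  \<open>fst e \<inter> W\<close>; together with \<open>e\<close> these exceed the bound
  \<open>r * card C\<close>.\<close>

lemma ex_greedy_coloring: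
  fixes f :: "'a set \<times> nat \<Rightarrow> nat"
  assumes fin: "finite F" "finite C" and A: "A \<subseteq> F" "f ` A \<subseteq> C"
    and deg: "\<And>c w. c \<in> C \<Longrightarrow> w \<in> W \<Longrightarrow> col_deg A f c w \<le> r"
    and touch: "\<And>e. e \<in> F - A \<Longrightarrow> fst e \<inter> W \<noteq> {} \<and>
      card {e'\<in>F. fst e' \<inter> (fst e \<inter> W) \<noteq> {}} \<le> r * card C"
  shows "\<exists>g. g ` F \<subseteq> C \<and> (\<forall>e\<in>A. g e = f e) \<and> (\<forall>c\<in>C. \<forall>w\<in>W. col_deg F g c w \<le> r)"
proof -
  have "\<exists>g. g ` (A \<union> B) \<subseteq> C \<and> (\<forall>e\<in>A. g e = f e) \<and> (\<forall>c\<in>C. \<forall>w\<in>W. col_deg (A \<union> B) g c w \<le> r)"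
    if "finite B" "B \<subseteq> F - A" for B
    using that
  proof (induction rule: finite_induct)
    case empty
    show ?case using A(2) deg by (intro exI[of _ f]) simp
  next
    case (insert e B)
    then obtain g where g: "g ` (A \<union> B) \<subseteq> C" "\<forall>e\<in>A. g e = f e"
      "\<forall>c\<in>C. \<forall>w\<in>W. col_deg (A \<union> B) g c w \<le> r" by auto
    have finAB: "finite (A \<union> B)" using insert.hyps(1) A(1) fin(1) by (auto intro: finite_subset)
    let ?T = "\<lambda>X. {e'\<in>X. fst e' \<inter> (fst e \<inter> W) \<noteq> {}}"
    have "\<exists>c\<in>C. \<forall>w\<in>fst e \<inter> W. col_deg (A \<union> B) g c w < r"
    proof (rule ccontr)
      assume "\<not> ?thesis"
      then have blocked: "\<And>c. c \<in> C \<Longrightarrow> \<exists>w\<in>fst e \<inter> W. r \<le> col_deg (A \<union> B) g c w"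
        by (auto simp: not_less)
      have "r \<le> card {e'\<in>?T (A \<union> B). g e' = c}" if c: "c \<in> C" for c
      proof -
        from blocked[OF c] obtain w where w: "w \<in> fst e \<inter> W" "r \<le> col_deg (A \<union> B) g c w" by blast
        have "col_deg (A \<union> B) g c w \<le> card {e'\<in>?T (A \<union> B). g e' = c}"
          unfolding col_deg_def using w(1) finAB by (intro card_mono) auto
        with w(2) show ?thesis by simp
      qed
      then have "(\<Sum>c\<in>C. r) \<le> (\<Sum>c\<in>C. card {e'\<in>?T (A \<union> B). g e' = c})" by (rule sum_mono)
      also have "\<dots> = card (?T (A \<union> B))"
        using finAB fin(2) g(1) sum.group[of "?T (A \<union> B)" C g "\<lambda>_. 1::nat"] by auto
      \<comment> \<open>Strict because \<open>e\<close> itself meets \<open>W\<close> and has no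
        colour yet.\<close>
      also have "\<dots> < card (?T F)"
      proof (rule psubset_card_mono)
        have "e \<in> ?T F" "e \<notin> ?T (A \<union> B)" using touch[of e] insert.hyps insert.prems by auto
        moreover have "?T (A \<union> B) \<subseteq> ?T F" using A(1) insert.prems by auto
        ultimately show "?T (A \<union> B) \<subset> ?T F" by blast
      qed (use fin in simp)
      finally show False using touch[of e] insert.prems by (simp add: mult.commute)
    qed
    then obtain c where c: "c \<in> C" "\<forall>w\<in>fst e \<inter> W. col_deg (A \<union> B) g c w < r" by blast
    have eAB: "e \<notin> A \<union> B" using insert.hyps insert.prems by auto
    let ?g = "g(e := c)"
    have ins: "A \<union> insert e B = {e} \<union> (A \<union> B)" by auto
    have "col_deg (A \<union> insert e B) ?g a w \<le> r" if aw: "a \<in> C" "w \<in> W" for a w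
    proof -
      have "col_deg (A \<union> insert e B) ?g a w = col_deg {e} ?g a w + col_deg (A \<union> B) ?g a w"
        unfolding ins using finAB eAB by (intro col_deg_Un) auto
      also have "col_deg (A \<union> B) ?g a w = col_deg (A \<union> B) g a w"
        using eAB by (intro col_deg_cong) auto
      also have "col_deg {e} ?g a w = (if a = c \<and> w \<in> fst e then 1 else 0)"
      proof -
        have "{e'\<in>{e}. ?g e' = a \<and> w \<in> fst e'} = (if a = c \<and> w \<in> fst e then {e} else {})" by auto
        then show ?thesis unfolding col_deg_def by simp
      qed
      finally have eq: "col_deg (A \<union> insert e B) ?g a w =
        (if a = c \<and> w \<in> fst e then 1 else 0) + col_deg (A \<union> B) g a w" .
      show ?thesis
      proof (cases "a = c \<and> w \<in> fst e")
        case True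
        with c(2) aw have "col_deg (A \<union> B) g a w < r" by blast
        with eq True show ?thesis by simp
      next
        case False
        with g(3) aw have "col_deg (A \<union> B) g a w \<le> r" by blast
        with eq False show ?thesis by (simp only: if_False)
      qed
    qed
    moreover have "?g ` (A \<union> insert e B) \<subseteq> C" using g(1) c(1) by auto
    moreover have "\<forall>e'\<in>A. ?g e' = f e'" using g(2) eAB by auto
    ultimately show ?case by blast
  qed
  from this[of "F - A"] fin(1) A(1) show ?thesis by (simp add: Un_absorb1)
qed

text \<open>\<open>Z\<close> is treated as if amalgamated into one vertex: only the degree sum over
  it is prescribed. Edges with a single vertex \<open>w\<close> in \<open>W\<close> fill up the
  degrees at \<open>w\<close>, and triples inside \<open>Z\<close> then fill up the degree sums; the
  work is to show that the demands are feasible and add up.\<close>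

lemma ex_amalgamated_coloring:
  fixes E :: "('a set \<times> nat) set"
  assumes fin: "finite E" "finite C" "finite W" "finite Z" and disj: "W \<inter> Z = {}"
    and E: "\<And>e. e \<in> E \<Longrightarrow> fst e \<subseteq> W \<union> Z \<and> card (fst e) = 3"
    and deg: "\<And>v. v \<in> W \<union> Z \<Longrightarrow> card {e\<in>E. v \<in> fst e} = r * card C"
    and size: "2 * card W \<le> card Z" and dvd: "3 dvd r * (card W + card Z)"
    and g2: "g2 ` {e\<in>E. 2 \<le> card (fst e \<inter> W)} \<subseteq> C"
      "\<And>c w. c \<in> C \<Longrightarrow> w \<in> W \<Longrightarrow> col_deg {e\<in>E. 2 \<le> card (fst e \<inter> W)} g2 c w \<le> r"
  shows "\<exists>g. g ` E \<subseteq> C \<and> (\<forall>e\<in>E. 2 \<le> card (fst e \<inter> W) \<longrightarrow> g e = g2 e) \<and>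
    (\<forall>c\<in>C. \<forall>w\<in>W. col_deg E g c w = r) \<and>
    (\<forall>c\<in>C. (\<Sum>z\<in>Z. col_deg E g c z) = r * card Z)"
proof -
  define F2 where "F2 = {e\<in>E. 2 \<le> card (fst e \<inter> W)}"
  define F1 where "F1 w = {e\<in>E. fst e \<inter> W = {w}}" for w
  define E' where "E' = {e\<in>E. fst e \<inter> W \<noteq> {}}"
  define E0 where "E0 = {e\<in>E. fst e \<inter> W = {}}"
  have finites: "finite F2" "finite (F1 w)" "finite E'" "finite E0" for w
    using fin by (auto simp: F2_def F1_def E'_def E0_def)
  have g2': "g2 ` F2 \<subseteq> C" using g2(1) by (simp add: F2_def)
  have at_w: "w \<in> fst e \<longleftrightarrow> e \<in> F2 \<and> w \<in> fst e \<or> e \<in> F1 w" if "e \<in> E" "w \<in> W" for e w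
  proof -
    have "finite (fst e \<inter> W)" using fin by simp
    moreover have "fst e \<inter> W = {w}" if "w \<in> fst e" "\<not> 2 \<le> card (fst e \<inter> W)"
    proof -
      have "card (fst e \<inter> W) \<le> Suc 0" using that(2) by simp
      with \<open>w \<in> W\<close> that(1) \<open>finite (fst e \<inter> W)\<close> show ?thesis
        using card_le_Suc0_iff_eq[of "fst e \<inter> W"] by blast
    qed
    ultimately show ?thesis using that by (auto simp: F2_def F1_def)
  qed
  have F12: "F2 \<inter> F1 w = {}" for w by (auto simp: F2_def F1_def)
  have "\<exists>h. (\<forall>e\<in>F1 w. h e \<in> C) \<and> (\<forall>c\<in>C. card {e\<in>F1 w. h e = c} = r - col_deg F2 g2 c w)"
    if w: "w \<in> W" for w
  proof (rule ex_function_with_fibers[OF fin(2) finites(2)])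
    have "{e\<in>E. w \<in> fst e} = {e\<in>F2. w \<in> fst e} \<union> F1 w"
      using at_w[OF _ w] by (auto simp: F2_def F1_def)
    then have "r * card C = card {e\<in>F2. w \<in> fst e} + card (F1 w)"
      using deg[of w] w F12[of w] finites by (simp only:) (subst card_Un_disjoint[symmetric]; auto)
    \<comment> \<open>The subtraction is exact because no degree exceeds \<open>r\<close>.\<close>
    moreover have "(\<Sum>c\<in>C. r - col_deg F2 g2 c w) + (\<Sum>c\<in>C. col_deg F2 g2 c w) = (\<Sum>c\<in>C. r)"
      using g2(2) w unfolding sum.distrib[symmetric] F2_def[symmetric] by (intro sum.cong) auto
    moreover have "(\<Sum>c\<in>C. col_deg F2 g2 c w) = card {e\<in>F2. w \<in> fst e}"
      using finites fin(2) g2' by (intro sum_col_deg_colors)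
    ultimately show "(\<Sum>c\<in>C. r - col_deg F2 g2 c w) = card (F1 w)" by (simp add: mult.commute)
  qed
  then have "\<forall>w\<in>W. \<exists>h. (\<forall>e\<in>F1 w. h e \<in> C) \<and>
      (\<forall>c\<in>C. card {e\<in>F1 w. h e = c} = r - col_deg F2 g2 c w)" by blast
  from bchoice[OF this] obtain h where h: "\<And>w. w \<in> W \<Longrightarrow> (\<forall>e\<in>F1 w. h w e \<in> C) \<and>
      (\<forall>c\<in>C. card {e\<in>F1 w. h w e = c} = r - col_deg F2 g2 c w)" by blast
  \<comment> \<open>Off \<open>F2\<close>, an edge of \<open>E'\<close> meets \<open>W\<close> in
    exactly one vertex, which \<open>the_elem\<close> returns.\<close>
  define g1 where "g1 e = (if e \<in> F2 then g2 e else h (the_elem (fst e \<inter> W)) e)" for e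
  have g1_F1: "g1 e = h w e" if "e \<in> F1 w" for e w
    using that F12[of w] by (auto simp: g1_def F1_def)
  have g1C: "g1 ` E' \<subseteq> C"
  proof (rule image_subsetI)
    fix e assume e: "e \<in> E'"
    then obtain w where w: "w \<in> W" "w \<in> fst e" "e \<in> E" by (auto simp: E'_def)
    with at_w[of e w] consider "e \<in> F2" | "e \<in> F1 w" by blast
    then show "g1 e \<in> C" using g2' h[OF w(1)] g1_F1 by cases (auto simp: g1_def)
  qed
  have degW: "col_deg E' g1 c w = r" if c: "c \<in> C" and w: "w \<in> W" for c w
  proof -
    have "{e\<in>E'. g1 e = c \<and> w \<in> fst e} =
      {e\<in>F2. g1 e = c \<and> w \<in> fst e} \<union> {e\<in>F1 w. g1 e = c}"
      using at_w[OF _ w] w by (auto simp: E'_def F2_def F1_def)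
    then have "col_deg E' g1 c w = col_deg F2 g1 c w + card {e\<in>F1 w. g1 e = c}"
      using finites F12[of w] unfolding col_deg_def
      by (simp only:) (intro card_Un_disjoint; auto)
    also have "{e\<in>F1 w. g1 e = c} = {e\<in>F1 w. h w e = c}" using g1_F1 by auto
    also have "col_deg F2 g1 c w = col_deg F2 g2 c w"
      by (intro col_deg_cong) (simp add: g1_def)
    finally show ?thesis using h[OF w] c g2(2)[OF c w] by (simp add: F2_def)
  qed
  have cards: "card (fst e \<inter> W) + card (fst e \<inter> Z) = 3" if "e \<in> E" for e
  proof -
    have "fst e = (fst e \<inter> W) \<union> (fst e \<inter> Z)" using E[OF that] by auto
    then have "card (fst e) = card (fst e \<inter> W) + card (fst e \<inter> Z)"
      using fin disj by (subst card_Un_disjoint[symmetric]) auto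
    with E[OF that] show ?thesis by simp
  qed
  define s where "s c = (\<Sum>z\<in>Z. col_deg E' g1 c z)" for c
  have sumW: "(\<Sum>e | e \<in> E' \<and> g1 e = c. card (fst e \<inter> W)) = r * card W" if "c \<in> C" for c
    using degW[OF that] finites fin sum_col_deg[of E' W g1 c] by (simp add: mult.commute)
  have s_eq: "s c = (\<Sum>e | e \<in> E' \<and> g1 e = c. card (fst e \<inter> Z))" for c
    using finites fin unfolding s_def by (intro sum_col_deg)
  \<comment> \<open>An edge meeting \<open>W\<close> has at most twice as many vertices in
    \<open>Z\<close> as in \<open>W\<close>, so the sum over \<open>Z\<close> so far is at most
    \<open>r * (2 * card W)\<close>.\<close>
  have s_le: "s c \<le> r * card Z" if c: "c \<in> C" for c
  proof -
    have "s c \<le> (\<Sum>e | e \<in> E' \<and> g1 e = c. 2 * card (fst e \<inter> W))"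
      unfolding s_eq
    proof (rule sum_mono)
      fix e assume "e \<in> {e \<in> E'. g1 e = c}"
      then have "e \<in> E" "fst e \<inter> W \<noteq> {}" by (auto simp: E'_def)
      moreover from this have "card (fst e \<inter> W) > 0" using fin by (simp add: card_gt_0_iff)
      ultimately show "card (fst e \<inter> Z) \<le> 2 * card (fst e \<inter> W)" using cards[of e] by linarith
    qed
    also have "\<dots> = r * (2 * card W)" using sumW[OF c] by (simp add: sum_distrib_left[symmetric])
    also have "\<dots> \<le> r * card Z" using size by (intro mult_left_mono) auto
    finally show ?thesis .
  qed
  \<comment> \<open>The edges of \<open>E'\<close> coloured \<open>c\<close> have
    \<open>s c + r * card W\<close> incidences, three each; compare with
    \<open>r * (card W + card Z)\<close>.\<close>
  have s_dvd: "3 dvd r * card Z - s c" if c: "c \<in> C" for c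
  proof -
    have "s c + r * card W = (\<Sum>e | e \<in> E' \<and> g1 e = c. 3)"
      unfolding s_eq sumW[OF c, symmetric] sum.distrib[symmetric]
      using cards by (intro sum.cong) (auto simp: E'_def add.commute)
    then have "3 dvd s c + r * card W" by simp
    moreover have "r * (card W + card Z) - (s c + r * card W) = r * card Z - s c"
      by (simp add: distrib_left)
    ultimately show ?thesis using dvd by (metis dvd_diff_nat)
  qed
  have E0: "fst e \<inter> Z = fst e" "card (fst e \<inter> Z) = 3" if "e \<in> E0" for e
    using that E[of e] cards[of e] by (auto simp: E0_def)
  have EE: "E = E' \<union> E0" "E' \<inter> E0 = {}" by (auto simp: E'_def E0_def)
  \<comment> \<open>Count the incidences at \<open>Z\<close>: \<open>r * card C\<close> for each
    vertex, of which every triple of \<open>E0\<close> accounts for three.\<close>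
  have "(\<Sum>c\<in>C. (r * card Z - s c) div 3) = card E0"
  proof -
    have "(\<Sum>c\<in>C. s c) = (\<Sum>z\<in>Z. card {e\<in>E'. z \<in> fst e})"
      unfolding s_def using finites fin(2) g1C
      by (subst sum.swap) (intro sum.cong sum_col_deg_colors; simp)
    moreover have "3 * card E0 = (\<Sum>z\<in>Z. card {e\<in>E0. z \<in> fst e})"
      using sum_col_deg[of E0 Z "\<lambda>_. 0" 0] E0 finites fin by (simp add: col_deg_def)
    moreover have "(\<Sum>z\<in>Z. card {e\<in>E'. z \<in> fst e}) + (\<Sum>z\<in>Z. card {e\<in>E0. z \<in> fst e}) = (\<Sum>z\<in>Z. r * card C)"
      unfolding sum.distrib[symmetric]
    proof (intro sum.cong refl)
      fix z assume z: "z \<in> Z"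
      have "{e\<in>E. z \<in> fst e} = {e\<in>E'. z \<in> fst e} \<union> {e\<in>E0. z \<in> fst e}" using EE by auto
      then show "card {e\<in>E'. z \<in> fst e} + card {e\<in>E0. z \<in> fst e} = r * card C"
        using EE(2) finites deg[of z] z by (subst card_Un_disjoint[symmetric]) auto
    qed
    moreover have "(\<Sum>c\<in>C. 3 * ((r * card Z - s c) div 3)) + (\<Sum>c\<in>C. s c) = (\<Sum>c\<in>C. r * card Z)"
      unfolding sum.distrib[symmetric]
    proof (intro sum.cong refl)
      fix c assume "c \<in> C"
      then show "3 * ((r * card Z - s c) div 3) + s c = r * card Z"
        using s_dvd s_le by (simp add: dvd_mult_div_cancel)
    qed
    ultimately have "3 * (\<Sum>c\<in>C. (r * card Z - s c) div 3) = 3 * card E0"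
      by (simp add: sum_distrib_left mult_ac)
    then show ?thesis by simp
  qed
  from ex_function_with_fibers[OF fin(2) finites(4) this] obtain h0 where
    h0: "\<forall>e\<in>E0. h0 e \<in> C" "\<forall>c\<in>C. card {e\<in>E0. h0 e = c} = (r * card Z - s c) div 3" by blast
  define g where "g e = (if e \<in> E0 then h0 e else g1 e)" for e
  have g_eq: "e \<in> E0 \<Longrightarrow> g e = h0 e" "e \<in> E' \<Longrightarrow> g e = g1 e" for e using EE(2) by (auto simp: g_def)
  have split: "col_deg E g c v = col_deg E' g1 c v + col_deg E0 h0 c v" for c v
    using col_deg_Un[OF finites(3,4) EE(2), of g c v] EE(1) col_deg_cong[of E' g g1] col_deg_cong[of E0 g h0] g_eq
    by simp
  have "col_deg E g c w = r" if "c \<in> C" "w \<in> W" for c w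
  proof -
    have "col_deg E0 h0 c w = 0" unfolding col_deg_def E0_def using that(2) by (intro card_eq_0_iff[THEN iffD2] disjI1) auto
    with that degW show ?thesis by (simp add: split)
  qed
  moreover have "(\<Sum>z\<in>Z. col_deg E g c z) = r * card Z" if "c \<in> C" for c
  proof -
    have "(\<Sum>z\<in>Z. col_deg E0 h0 c z) = (\<Sum>e | e \<in> E0 \<and> h0 e = c. 3)"
      unfolding sum_col_deg[OF finites(4) fin(4)] by (intro sum.cong) (simp_all add: E0(2))
    then have "(\<Sum>z\<in>Z. col_deg E0 h0 c z) = 3 * ((r * card Z - s c) div 3)"
      using h0(2) that by simp
    with s_dvd[OF that] s_le[OF that] show ?thesis
      by (simp add: split sum.distrib s_def[symmetric] dvd_mult_div_cancel)
  qed
  moreover have "g ` E \<subseteq> C" using EE(1) g_eq h0(1) g1C by auto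
  moreover have "g e = g2 e" if "e \<in> E" "2 \<le> card (fst e \<inter> W)" for e
    using that by (auto simp: g_def g1_def E0_def F2_def)
  ultimately show ?thesis by (intro exI[of _ g]) blast
qed

section \<open>Complete 3-uniform hypergraphs\<close>

definition triples :: "'a set \<Rightarrow> nat \<Rightarrow> ('a set \<times> nat) set" where
  "triples V lam = {S. S \<subseteq> V \<and> card S = 3} \<times> {..<lam}"

lemma finite_triples: "finite V \<Longrightarrow> finite (triples V lam)"
  by (auto simp: triples_def)

lemma exchangeable_triples:
  assumes "finite V" "Z \<subseteq> V"
  shows "exchangeable (triples V lam) Z"
proof -
  have "transpose x y ` S \<subseteq> V" "card (transpose x y ` S) = card S" if "x \<in> Z" "y \<in> Z" "S \<subseteq> V" for x y S
  proof -
    show "transpose x y ` S \<subseteq> V" using that assms(2) by (auto simp: transpose_def)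
    show "card (transpose x y ` S) = card S"
      by (rule card_image, rule inj_on_subset[OF inj_transpose]) simp
  qed
  then show ?thesis
    using assms finite_triples[of V lam] finite_subset[of Z V]
    by (auto simp: exchangeable_def triples_def)
qed

lemma card_triples_at:
  assumes "finite A" "v \<notin> A" "insert v A \<subseteq> V"
  shows "card {e\<in>triples V lam. v \<in> fst e \<and> fst e - {v} \<subseteq> A} = lam * (card A choose 2)"
proof -
  have "bij_betw (insert v) {P. P \<subseteq> A \<and> card P = 2} {S. v \<in> S \<and> S \<subseteq> insert v A \<and> card S = 3}"
  proof (rule bij_betw_byWitness[where f' = "\<lambda>S. S - {v}"])
    show "insert v ` {P. P \<subseteq> A \<and> card P = 2} \<subseteq> {S. v \<in> S \<and> S \<subseteq> insert v A \<and> card S = 3}"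
    proof clarify
      fix P assume P: "P \<subseteq> A" "card P = 2"
      then have "finite P" "v \<notin> P" using assms by (auto intro: finite_subset)
      with P show "v \<in> insert v P \<and> insert v P \<subseteq> insert v A \<and> card (insert v P) = 3" by auto
    qed
    show "(\<lambda>S. S - {v}) ` {S. v \<in> S \<and> S \<subseteq> insert v A \<and> card S = 3} \<subseteq> {P. P \<subseteq> A \<and> card P = 2}"
      by auto
  qed (use assms in auto)
  then have "card {S. v \<in> S \<and> S \<subseteq> insert v A \<and> card S = 3} = card A choose 2"
    using n_subsets[OF assms(1), of 2] by (simp add: bij_betw_same_card)
  moreover have "{e\<in>triples V lam. v \<in> fst e \<and> fst e - {v} \<subseteq> A} =
    {S. v \<in> S \<and> S \<subseteq> insert v A \<and> card S = 3} \<times> {..<lam}"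
    using assms(3) by (auto simp: triples_def)
  ultimately show ?thesis by (simp add: card_cartesian_product)
qed

text \<open>Split by whether \<open>u\<close> lies on the edge. In each part take all triples at the
  vertex and discard those whose other two vertices are outside \<open>W\<close>; the discarded
  terms stand on the left to avoid subtraction.\<close>

lemma card_triples_touching:
  assumes "finite V" "W \<subseteq> V" "u \<in> W" "v \<in> W" "u \<noteq> v"
  shows "card {e\<in>triples V lam. 2 \<le> card (fst e \<inter> W) \<and> fst e \<inter> {u, v} \<noteq> {}} +
      lam * 2 * (card (V - W) choose 2) =
    lam * ((card V - 1) choose 2) + lam * ((card V - 2) choose 2)"
proof -
  let ?T = "triples V lam"
  have fin: "finite ?T" "finite W" using assms by (auto intro: finite_triples finite_subset)
  have one: "2 \<le> card (fst e \<inter> W) \<longleftrightarrow> \<not> fst e - {w} \<subseteq> V - W" if "e \<in> ?T" "w \<in> fst e" "w \<in> W" for e w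
  proof
    assume "2 \<le> card (fst e \<inter> W)"
    then have "fst e \<inter> W \<noteq> {w}" by auto
    then show "\<not> fst e - {w} \<subseteq> V - W" using that by auto
  next
    assume "\<not> fst e - {w} \<subseteq> V - W"
    moreover have "fst e \<subseteq> V" using that by (auto simp: triples_def)
    ultimately obtain w' where "w' \<in> fst e \<inter> W" "w' \<noteq> w" by blast
    then have "{w, w'} \<subseteq> fst e \<inter> W" "card {w, w'} = 2" using that by auto
    then show "2 \<le> card (fst e \<inter> W)" using fin card_mono[of "fst e \<inter> W" "{w, w'}"] by simp
  qed
  have u: "u \<in> V" "v \<in> V" using assms by auto
  let ?A = "{e\<in>?T. 2 \<le> card (fst e \<inter> W) \<and> u \<in> fst e}"
  let ?B = "{e\<in>?T. 2 \<le> card (fst e \<inter> W) \<and> v \<in> fst e \<and> u \<notin> fst e}"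
  have "{e\<in>?T. 2 \<le> card (fst e \<inter> W) \<and> fst e \<inter> {u, v} \<noteq> {}} = ?A \<union> ?B" by auto
  then have "card {e\<in>?T. 2 \<le> card (fst e \<inter> W) \<and> fst e \<inter> {u, v} \<noteq> {}} = card ?A + card ?B"
    using fin by (simp only:) (intro card_Un_disjoint; auto)
  moreover have "card ?A + lam * (card (V - W) choose 2) = lam * ((card V - 1) choose 2)"
  proof -
    have "{e\<in>?T. u \<in> fst e \<and> fst e - {u} \<subseteq> V - {u}} = ?A \<union> {e\<in>?T. u \<in> fst e \<and> fst e - {u} \<subseteq> V - W}"
      using one assms(3) by (auto simp: triples_def)
    moreover have "card (?A \<union> {e\<in>?T. u \<in> fst e \<and> fst e - {u} \<subseteq> V - W}) =
      card ?A + card {e\<in>?T. u \<in> fst e \<and> fst e - {u} \<subseteq> V - W}"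
      using one assms(3) fin by (intro card_Un_disjoint) auto
    ultimately show ?thesis
      using card_triples_at[of "V - {u}" u V lam] card_triples_at[of "V - W" u V lam] assms u by auto
  qed
  moreover have "card ?B + lam * (card (V - W) choose 2) = lam * ((card V - 2) choose 2)"
  proof -
    have "{e\<in>?T. v \<in> fst e \<and> fst e - {v} \<subseteq> V - {u, v}} = ?B \<union> {e\<in>?T. v \<in> fst e \<and> fst e - {v} \<subseteq> V - W}"
      using one assms(3-5) by (auto simp: triples_def)
    moreover have "card (?B \<union> {e\<in>?T. v \<in> fst e \<and> fst e - {v} \<subseteq> V - W}) =
      card ?B + card {e\<in>?T. v \<in> fst e \<and> fst e - {v} \<subseteq> V - W}"
      using one assms(4) fin by (intro card_Un_disjoint) auto
    moreover have "card (V - {u, v}) = card V - 2"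
      using assms u by (simp add: card_Diff_subset)
    ultimately show ?thesis
      using card_triples_at[of "V - {u, v}" v V lam] card_triples_at[of "V - W" v V lam] assms u by auto
  qed
  ultimately show ?thesis by simp
qed

section \<open>Consequences of the bound on \<open>n\<close>\<close>

lemma two_times_choose_two: "2 * (n choose 2) = n * (n - 1)"
  by (cases n) (simp_all add: choose_two)

text \<open>\<open>2 * m \<le> n - m\<close> serves the degree sums over \<open>Z\<close> and the
  count of children; the inequality of binomials keeps a colour free in the greedy stage.\<close>

lemma size_bounds:
  fixes n m :: nat
  assumes m: "m > 3" and n: "real n > 2 * real m + (sqrt (8 * (real m)^2 - 16 * real m - 7) - 1) / 2"
  shows "2 * m \<le> n - m" "m \<le> n" "(n - 2) choose 2 \<le> 2 * ((n - m) choose 2)"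
proof -
  let ?D = "8 * (real m)^2 - 16 * real m - 7"
  have "real m * 4 \<le> real m * real m" using m by (intro mult_left_mono) auto
  moreover have "4 \<le> real m" using m by simp
  ultimately have "?D \<ge> 0" unfolding power2_eq_square by linarith
  \<comment> \<open>The bound on \<open>n\<close> says exactly that \<open>x\<close> exceeds the
    square root, so squaring makes it polynomial.\<close>
  define x where "x = 2 * real n - 4 * real m + 1"
  define s where "s = sqrt ?D"
  have "real n > 2 * real m + (s - 1) / 2" using n by (simp add: s_def)
  then have gx: "sqrt ?D < x" unfolding x_def s_def[symmetric] by (simp add: field_simps)
  then have "(sqrt ?D)^2 < x^2" using \<open>?D \<ge> 0\<close> by (intro power_strict_mono) auto
  then have "?D < x^2" using \<open>?D \<ge> 0\<close> by simp
  have "x > 0" using gx real_sqrt_ge_zero[OF \<open>?D \<ge> 0\<close>] by linarith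
  then have mn: "2 * real m < real n + 1" using m by (simp add: x_def)
  then have "2 * m \<le> n" by linarith
  define N where "N = n - m"
  have N: "n = m + N" "m \<le> N" using \<open>2 * m \<le> n\<close> by (simp_all add: N_def)
  \<comment> \<open>Here \<open>x = 2 * N - 2 * m + 1\<close>, and a quarter of the squared bound is
    this inequality.\<close>
  have ineq: "real m * real m < real N * real N + real N + 3 * real m + 2 - 2 * real N * real m"
    using \<open>?D < x^2\<close> unfolding x_def N by (simp add: power2_eq_square algebra_simps)
  then have "real (m * m + 2 * N * m) < real (N * N + N + 3 * m + 2)" by simp
  then have nat_ineq: "m * m + 2 * N * m < N * N + N + 3 * m + 2" by (simp only: of_nat_less_iff)
  show "m \<le> n" using N by simp
  \<comment> \<open>If \<open>N + 1 \<le> 2 * m\<close>, then \<open>nat_ineq\<close> yields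
    \<open>m * m < 3 * m + 2\<close>, which fails for \<open>m > 3\<close>.\<close>
  have "2 * m \<le> N"
  proof (rule ccontr)
    assume "\<not> 2 * m \<le> N"
    then have "N * (N + 1) \<le> N * (2 * m)" by (intro mult_left_mono) auto
    moreover have "4 * m \<le> m * m" using m by simp
    ultimately show False using nat_ineq m by (simp add: algebra_simps)
  qed
  then show "2 * m \<le> n - m" using N by simp
  \<comment> \<open>Shifting \<open>m\<close> and \<open>N\<close> removes the truncated
    subtractions; the claim then follows from \<open>nat_ineq\<close> with
    \<open>2 * N + 2 * m - 7\<close> to spare.\<close>
  obtain M where M: "m = M + 3" using m le_Suc_ex[of 3 m] by auto
  obtain N' where N': "N = Suc N'" using \<open>2 * m \<le> N\<close> m by (cases N) auto
  have "(n - 2) * (n - 2 - 1) \<le> 2 * (N * (N - 1))"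
    using nat_ineq \<open>2 * m \<le> N\<close> unfolding N(1) M N' by (simp add: algebra_simps)
  then have "2 * ((n - 2) choose 2) \<le> 2 * (2 * (N choose 2))"
    unfolding two_times_choose_two by simp
  then show "(n - 2) choose 2 \<le> 2 * ((n - m) choose 2)" using N by simp
qed

text \<open>All edges at a vertex of a component lie inside the component, so its degree there
  equals its degree in \<open>K\<close>.\<close>

lemma regular_component_iff:
  assumes "\<And>e. e \<in> hedges K \<Longrightarrow> fst e \<subseteq> hverts K"
  shows "(\<exists>C\<in>hg_components K. hg_regular r C) \<longleftrightarrow>
    (\<exists>w\<in>hverts K. \<forall>v. (w, v) \<in> hg_reach K \<longrightarrow> hg_degree K v = r)"
proof -
  have deg: "hg_degree (hg_induced K (hg_reach K `` {w})) v = hg_degree K v"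
    if wv: "(w, v) \<in> hg_reach K" for w v
  proof -
    have "fst e \<subseteq> hg_reach K `` {w}" if e: "e \<in> hedges K" "v \<in> fst e" for e
    proof
      fix u assume u: "u \<in> fst e"
      then have "(v, u) \<in> hg_adj K" using e by (auto simp: hg_adj_def)
      with wv have "(w, u) \<in> (hg_adj K)\<^sup>*" by (auto simp: hg_reach_def intro: rtrancl_into_rtrancl)
      with wv u assms[OF e(1)] show "u \<in> hg_reach K `` {w}" by (auto simp: hg_reach_def)
    qed
    then have "{e \<in> hedges (hg_induced K (hg_reach K `` {w})). v \<in> fst e} = {e \<in> hedges K. v \<in> fst e}"
      by (auto simp: hg_induced_def)
    then show ?thesis by (simp add: hg_degree_def)
  qed
  have "hg_regular r (hg_induced K (hg_reach K `` {w})) \<longleftrightarrow>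
      (\<forall>v. (w, v) \<in> hg_reach K \<longrightarrow> hg_degree K v = r)" for w
  proof -
    have "hverts (hg_induced K (hg_reach K `` {w})) = hg_reach K `` {w}"
      by (auto simp: hg_induced_def hg_reach_def)
    then show ?thesis unfolding hg_regular_def using deg[of w] by (simp add: Ball_def)
  qed
  then show ?thesis by (auto simp: hg_components_def quotient_def)
qed

section \<open>The given hypergraphs and the two directions of the equivalence\<close>

context
  fixes n m r lam k :: nat and V W :: "'a set" and H G :: "'a hypergraph"
    and f :: "'a set \<times> nat \<Rightarrow> nat"
  assumes V: "finite V" "card V = n" and W: "W \<subseteq> V" "card W = m"
    and H: "H = hg_complete lam 3 V" and G: "G = hg_induced H W"
begin

abbreviation (input) "E \<equiv> triples V lam"
abbreviation (input) "EG \<equiv> {e\<in>triples V lam. fst e \<subseteq> W}"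

lemma hedges_H: "hverts H = V" "hedges H = E"
  by (simp_all add: H hg_complete_def triples_def)

lemma hedges_G: "hverts G = W" "hedges G = EG"
  using W(1) by (auto simp: G hg_induced_def hedges_H)

lemma finite_E: "finite E" and finite_W: "finite W"
  using V W by (auto intro: finite_triples finite_subset)

lemma E_edge: "e \<in> E \<Longrightarrow> fst e \<subseteq> V \<and> card (fst e) = 3"
  by (auto simp: triples_def)

lemma class_degree:
  "hg_degree (color_class H g c) v = col_deg E g c v"
  "hg_degree (color_class G g c) v = col_deg EG g c v"
  by (auto simp: hg_degree_def color_class_def col_deg_def hedges_H hedges_G conj_assoc
      intro!: arg_cong[of _ _ card])

lemma class_reach:
  "hg_reach (color_class H g c) = {(u, v). u \<in> V \<and> v \<in> V \<and> (u, v) \<in> (col_adj E g c)\<^sup>*}"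
  "hg_reach (color_class G g c) = {(u, v). u \<in> W \<and> v \<in> W \<and> (u, v) \<in> (col_adj EG g c)\<^sup>*}"
proof -
  have "hg_adj (color_class H g c) = col_adj E g c" "hg_adj (color_class G g c) = col_adj EG g c"
    by (simp_all add: hg_adj_def color_class_def col_adj_def hedges_H hedges_G Bex_def conj_assoc)
  then show "hg_reach (color_class H g c) = {(u, v). u \<in> V \<and> v \<in> V \<and> (u, v) \<in> (col_adj E g c)\<^sup>*}"
    "hg_reach (color_class G g c) = {(u, v). u \<in> W \<and> v \<in> W \<and> (u, v) \<in> (col_adj EG g c)\<^sup>*}"
    by (simp_all add: hg_reach_def color_class_def hedges_H hedges_G)
qed

lemma reach_EG_in_W: "(w, v) \<in> (col_adj EG g c)\<^sup>* \<Longrightarrow> w \<in> W \<Longrightarrow> v \<in> W"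
  by (induction rule: rtrancl_induct) (auto simp: col_adj_def)

lemma regular_component_G_iff:
  "(\<exists>C\<in>hg_components (color_class G f c). hg_regular r C) \<longleftrightarrow>
    (\<exists>w\<in>W. \<forall>v. (w, v) \<in> (col_adj EG f c)\<^sup>* \<longrightarrow> col_deg EG f c v = r)"
proof -
  have "(\<exists>C\<in>hg_components (color_class G f c). hg_regular r C) \<longleftrightarrow>
    (\<exists>w\<in>hverts (color_class G f c). \<forall>v. (w, v) \<in> hg_reach (color_class G f c) \<longrightarrow>
      hg_degree (color_class G f c) v = r)"
    by (rule regular_component_iff) (auto simp: color_class_def hedges_G)
  also have "hverts (color_class G f c) = W" by (simp add: color_class_def hedges_G)
  finally show ?thesis
    unfolding class_degree class_reach using reach_EG_in_W by simp meson
qed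

lemma partial_factorization_iff:
  "partial_factorization r k G f \<longleftrightarrow> f ` EG \<subseteq> {1..k} \<and> (\<forall>c\<in>{1..k}. \<forall>w\<in>W. col_deg EG f c w \<le> r)"
  by (auto simp: partial_factorization_def hg_coloring_def class_degree hedges_G image_subset_iff)

lemma connected_factorization_iff:
  assumes "V \<noteq> {}"
  shows "connected_factorization r k H g \<longleftrightarrow> g ` E \<subseteq> {1..k} \<and>
    (\<forall>c\<in>{1..k}. (\<forall>v\<in>V. col_deg E g c v = r) \<and> col_connected E g c V)"
proof -
  have "hg_factor r (color_class H g c) H \<longleftrightarrow> (\<forall>v\<in>V. col_deg E g c v = r)" for c
    by (auto simp: hg_factor_def hg_spanning_sub_def hg_regular_def class_degree)
      (auto simp: color_class_def hedges_H)
  moreover have "hg_connected (color_class H g c) \<longleftrightarrow> col_connected E g c V" for c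
    using assms unfolding hg_connected_def col_connected_def class_reach
    by (auto simp: color_class_def hedges_H)
  moreover have "hg_coloring k H g \<longleftrightarrow> g ` E \<subseteq> {1..k}"
    by (auto simp: hg_coloring_def hedges_H)
  ultimately show ?thesis by (simp add: connected_factorization_def)
qed

lemma total_degree: "v \<in> V \<Longrightarrow> card {e\<in>E. v \<in> fst e} = lam * ((n - 1) choose 2)"
proof -
  assume v: "v \<in> V"
  have "{e\<in>E. v \<in> fst e} = {e\<in>E. v \<in> fst e \<and> fst e - {v} \<subseteq> V - {v}}"
    by (auto simp: triples_def)
  with card_triples_at[of "V - {v}" v V lam] v V show ?thesis by auto
qed

text \<open>Admissibility comes from adding degrees at one vertex over all colours, and in one
  colour over all vertices. At the vertices of an \<open>r\<close>-regular component the class is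
  already full, so an extension adds no edge there and the component stays cut off from
  \<open>V - W\<close>.\<close>

lemma necessity:
  assumes ext: "extends_to_connected_factorization r k G H f" and f: "f ` EG \<subseteq> {1..k}"
    and m: "3 \<le> m" "m < n" and lam: "0 < lam"
  shows "admissible 3 n r lam"
    and "\<forall>c\<in>{1..k}. \<forall>C\<in>hg_components (color_class G f c). \<not> hg_regular r C"
proof -
  have "V \<noteq> {}" using m V by auto
  from ext obtain g where g: "\<forall>e\<in>EG. g e = f e" "g ` E \<subseteq> {1..k}"
    "\<forall>c\<in>{1..k}. (\<forall>v\<in>V. col_deg E g c v = r) \<and> col_connected E g c V"
    unfolding extends_to_connected_factorization_def connected_factorization_iff[OF \<open>V \<noteq> {}\<close>] hedges_G
    by (elim exE conjE) (rule that)
  from g(1) have gf: "\<And>e. e \<in> EG \<Longrightarrow> g e = f e" by (rule bspec)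
  from g(3) have deg: "\<And>c v. c \<in> {1..k} \<Longrightarrow> v \<in> V \<Longrightarrow> col_deg E g c v = r"
    and conn: "\<And>c. c \<in> {1..k} \<Longrightarrow> col_connected E g c V" by blast+
  have "3 \<le> card W" using m W by simp
  then obtain S where S: "S \<subseteq> W" "card S = 3" "finite S" by (rule obtain_subset_with_card_n)
  then have "(S, 0) \<in> EG" using W lam by (auto simp: triples_def)
  \<comment> \<open>A triple inside \<open>W\<close> has a colour, so there is a class in which to
    count.\<close>
  then have k: "1 \<in> {1..k}" using f by fastforce
  obtain v where v: "v \<in> V" using \<open>V \<noteq> {}\<close> by auto
  have "(\<Sum>c\<in>{1..k}. col_deg E g c v) = lam * ((n - 1) choose 2)"
    using sum_col_deg_colors[OF finite_E _ g(2)] total_degree[OF v] by simp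
  then have "lam * ((n - 1) choose 2) = k * r" using deg v by simp
  moreover have "(\<Sum>v\<in>V. col_deg E g 1 v) = (\<Sum>e | e \<in> E \<and> g e = 1. 3)"
    unfolding sum_col_deg[OF finite_E V(1)]
  proof (intro sum.cong refl)
    fix e assume "e \<in> {e \<in> E. g e = 1}"
    then show "card (fst e \<inter> V) = 3" using E_edge[of e] by (simp add: Int_absorb2)
  qed
  then have "3 dvd n * r" using deg[OF k] V by simp
  ultimately show "admissible 3 n r lam" by (simp add: admissible_def mult.commute)
  have "\<not> (\<forall>v. (w, v) \<in> (col_adj EG f c)\<^sup>* \<longrightarrow> col_deg EG f c v = r)"
    if c: "c \<in> {1..k}" and w: "w \<in> W" for c w
  proof
    assume reg: "\<forall>v. (w, v) \<in> (col_adj EG f c)\<^sup>* \<longrightarrow> col_deg EG f c v = r"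
    have closed: "(w, v) \<in> (col_adj EG f c)\<^sup>*" if "(w, v) \<in> (col_adj E g c)\<^sup>*" for v
      using that
    proof induction
      case (step u v)
      have uW: "u \<in> W" using reach_EG_in_W[OF step.IH w] .
      have "col_deg EG g c u = r"
        using reg step.IH col_deg_cong[of EG g f c u] gf by simp
      then have "card {e\<in>EG. g e = c \<and> u \<in> fst e} = card {e\<in>E. g e = c \<and> u \<in> fst e}"
        using deg[OF c, of u] uW W by (auto simp: col_deg_def)
      then have eq: "{e\<in>EG. g e = c \<and> u \<in> fst e} = {e\<in>E. g e = c \<and> u \<in> fst e}"
        using finite_E by (intro card_subset_eq) auto
      obtain e where "e \<in> E" "g e = c" "u \<in> fst e" "v \<in> fst e"
        using step.hyps(2) by (auto simp: col_adj_def)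
      moreover from this have "e \<in> EG" using eq by blast
      ultimately have "(u, v) \<in> col_adj EG f c" using gf by (intro col_adjI[of e]) auto
      with step.IH show ?case by (rule rtrancl_into_rtrancl)
    qed simp
    obtain z where z: "z \<in> V" "z \<notin> W" using m V W by (metis less_irrefl subsetI subset_antisym)
    then have "(w, z) \<in> (col_adj E g c)\<^sup>*" using conn[OF c] w W by (auto simp: col_connected_def)
    with closed reach_EG_in_W w z show False by blast
  qed
  then show "\<forall>c\<in>{1..k}. \<forall>C\<in>hg_components (color_class G f c). \<not> hg_regular r C"
    using regular_component_G_iff by blast
qed

text \<open>For \<open>r = 1\<close>, no other edge of its class meets a given edge inside
  \<open>W\<close>, which is thus a regular component by itself. Irregularity therefore forces
  \<open>r \<ge> 2\<close>.\<close>

lemma one_regular_component: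
  assumes "f ` EG \<subseteq> {1..k}" "\<forall>c\<in>{1..k}. \<forall>w\<in>W. col_deg EG f c w \<le> 1" "3 \<le> m" "0 < lam"
  shows "\<exists>c\<in>{1..k}. \<exists>w\<in>W. \<forall>v. (w, v) \<in> (col_adj EG f c)\<^sup>* \<longrightarrow> col_deg EG f c v = 1"
proof -
  have "3 \<le> card W" using assms W by simp
  then obtain S where S: "S \<subseteq> W" "card S = 3" "finite S" by (rule obtain_subset_with_card_n)
  define e where "e = (S, 0::nat)"
  have e: "e \<in> EG" "fst e = S" using S W assms(4) by (auto simp: triples_def e_def)
  have c: "f e \<in> {1..k}" using e assms(1) by auto
  have at: "{e'\<in>EG. f e' = f e \<and> v \<in> fst e'} = {e}" if v: "v \<in> S" for v
  proof (rule sym, rule card_subset_eq)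
    have "card {e'\<in>EG. f e' = f e \<and> v \<in> fst e'} \<le> 1"
      using assms(2) c v S by (auto simp: col_deg_def)
    moreover have "{e} \<subseteq> {e'\<in>EG. f e' = f e \<and> v \<in> fst e'}" using e v by auto
    ultimately show "{e} \<subseteq> {e'\<in>EG. f e' = f e \<and> v \<in> fst e'}"
      "card {e} = card {e'\<in>EG. f e' = f e \<and> v \<in> fst e'}"
      using finite_E card_mono[of "{e'\<in>EG. f e' = f e \<and> v \<in> fst e'}" "{e}"] by auto
  qed (use finite_E in simp)
  obtain w where w: "w \<in> S" using S by fastforce
  have "v \<in> S" if "(w, v) \<in> (col_adj EG f (f e))\<^sup>*" for v
    using that
  proof induction
    case (step u v)
    then obtain e' where "e' \<in> {e'\<in>EG. f e' = f e \<and> u \<in> fst e'}" "v \<in> fst e'"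
      by (auto simp: col_adj_def)
    with at[OF step.IH] e show ?case by simp
  qed (use w in simp)
  then have "\<forall>v. (w, v) \<in> (col_adj EG f (f e))\<^sup>* \<longrightarrow> col_deg EG f (f e) v = 1"
    using at by (simp add: col_deg_def)
  with c w S show ?thesis by blast
qed

text \<open>Otherwise the component of \<open>w\<close> under \<open>g\<close> stays in
  \<open>W\<close>. Its edges then keep the colours of \<open>f\<close>, and the component of
  \<open>w\<close> in the given class is \<open>r\<close>-regular.\<close>

lemma reaches_outside:
  assumes g: "regular_extension E {1..k} r W (V - W) f g" and c: "c \<in> {1..k}" and w: "w \<in> W"
    and irreg: "\<forall>C\<in>hg_components (color_class G f c). \<not> hg_regular r C"
  shows "\<exists>z\<in>V - W. (w, z) \<in> (col_adj E g c)\<^sup>*"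
proof (rule ccontr)
  assume contra: "\<not> ?thesis"
  have gf: "g e = f e" if "e \<in> EG" for e
    using g that by (auto simp: regular_extension_def)
  have inV: "v \<in> V" if "(w, v) \<in> (col_adj E g c)\<^sup>*" for v
    using that w W E_edge by (induction rule: rtrancl_induct) (auto simp: col_adj_def)
  have inW: "v \<in> W" if "(w, v) \<in> (col_adj E g c)\<^sup>*" for v
    using that contra inV by blast
  have "col_adj EG f c \<subseteq> col_adj E g c"
  proof clarify
    fix u v assume "(u, v) \<in> col_adj EG f c"
    then obtain e where e: "e \<in> EG" "f e = c" "u \<in> fst e" "v \<in> fst e"
      unfolding col_adj_def by blast
    with gf[OF e(1)] show "(u, v) \<in> col_adj E g c" by (intro col_adjI[of e]) auto
  qed
  then have sub: "(w, v) \<in> (col_adj EG f c)\<^sup>* \<Longrightarrow> (w, v) \<in> (col_adj E g c)\<^sup>*" for v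
    using rtrancl_mono by blast
  have "col_deg EG f c v = r" if v: "(w, v) \<in> (col_adj EG f c)\<^sup>*" for v
  proof -
    have "fst e \<subseteq> W" if "e \<in> E" "g e = c" "v \<in> fst e" for e
    proof
      fix u assume "u \<in> fst e"
      with that have "(v, u) \<in> col_adj E g c" by (rule col_adjI)
      then show "u \<in> W" by (rule inW[OF rtrancl_into_rtrancl[OF sub[OF v]]])
    qed
    then have inEG: "e \<in> EG" if "e \<in> E" "g e = c" "v \<in> fst e" for e using that by simp
    have "{e\<in>EG. f e = c \<and> v \<in> fst e} = {e\<in>E. g e = c \<and> v \<in> fst e}"
    proof (intro set_eqI iffI)
      fix e assume "e \<in> {e\<in>EG. f e = c \<and> v \<in> fst e}"
      with gf[of e] show "e \<in> {e\<in>E. g e = c \<and> v \<in> fst e}" by simp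
    next
      fix e assume "e \<in> {e\<in>E. g e = c \<and> v \<in> fst e}"
      with gf[of e] inEG[of e] show "e \<in> {e\<in>EG. f e = c \<and> v \<in> fst e}" by simp
    qed
    moreover have "col_deg E g c v = r"
      using g c inW[OF sub[OF v]] by (auto simp: regular_extension_def)
    ultimately show ?thesis by (simp add: col_deg_def)
  qed
  with irreg regular_component_G_iff w show False by blast
qed

lemma sufficiency:
  assumes pf: "partial_factorization r k G f" and adm: "admissible 3 n r lam"
    and irreg: "\<forall>c\<in>{1..k}. \<forall>C\<in>hg_components (color_class G f c). \<not> hg_regular r C"
    and k: "r * k = lam * ((n - 1) choose 2)" and pos: "0 < r" "0 < lam" "3 \<le> m"
    and size: "2 * m \<le> n - m" "(n - 2) choose 2 \<le> 2 * ((n - m) choose 2)"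
  shows "extends_to_connected_factorization r k G H f"
proof -
  define Z where "Z = V - W"
  have Z: "finite Z" "W \<inter> Z = {}" "W \<union> Z = V" "card Z = n - m"
    using V W finite_W by (auto simp: Z_def card_Diff_subset)
  have mn: "m \<le> n" using V W by (auto intro: card_mono)
  have f: "f ` EG \<subseteq> {1..k}" "\<forall>c\<in>{1..k}. \<forall>w\<in>W. col_deg EG f c w \<le> r"
    using pf partial_factorization_iff by auto
  have r2: "r \<ge> 2"
  proof (rule ccontr)
    assume "\<not> r \<ge> 2"
    then have "r = 1" using pos by simp
    with one_regular_component[OF f(1)] f(2) pos irreg regular_component_G_iff show False by simp blast
  qed
  let ?F = "{e\<in>E. 2 \<le> card (fst e \<inter> W)}"
  have cardW: "card (fst e \<inter> W) = 3 \<longleftrightarrow> fst e \<subseteq> W" if "e \<in> E" for e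
  proof
    assume "card (fst e \<inter> W) = 3"
    with E_edge[OF that] have "fst e \<inter> W = fst e"
      by (intro card_subset_eq) (auto intro: card_ge_0_finite)
    then show "fst e \<subseteq> W" by auto
  qed (use E_edge[OF that] in \<open>simp add: Int_absorb2\<close>)
  have EGF: "EG \<subseteq> ?F"
  proof clarify
    fix S i assume "(S, i) \<in> E" "fst (S, i) \<subseteq> W"
    with cardW[of "(S, i)"] show "2 \<le> card (fst (S, i) \<inter> W)" by simp
  qed
  \<comment> \<open>Greedy stage. An edge of \<open>?F\<close> not inside \<open>W\<close> has
    exactly two vertices \<open>u\<close>, \<open>v\<close> in \<open>W\<close>, and by the binomial
    bound at most \<open>lam * ((n - 1) choose 2) = r * k\<close> edges of \<open>?F\<close> meet
    them.\<close>
  have "\<exists>g. g ` ?F \<subseteq> {1..k} \<and> (\<forall>e\<in>EG. g e = f e) \<and> (\<forall>c\<in>{1..k}. \<forall>w\<in>W. col_deg ?F g c w \<le> r)"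
  proof (rule ex_greedy_coloring[OF _ _ EGF f(1)])
    fix e assume e: "e \<in> ?F - EG"
    have "card (fst e \<inter> W) \<le> 3"
      using E_edge[of e] e card_mono[of "fst e" "fst e \<inter> W"] card_ge_0_finite[of "fst e"] by simp
    moreover have "card (fst e \<inter> W) \<noteq> 3" using e cardW by auto
    ultimately have "card (fst e \<inter> W) = 2" using e by auto
    then obtain u v where uv: "fst e \<inter> W = {u, v}" "u \<noteq> v" by (auto simp: card_2_iff)
    have "card {e'\<in>?F. fst e' \<inter> (fst e \<inter> W) \<noteq> {}} \<le> lam * ((n - 1) choose 2)"
    proof -
      let ?X = "{e\<in>E. 2 \<le> card (fst e \<inter> W) \<and> fst e \<inter> {u, v} \<noteq> {}}"
      have "u \<in> W" "v \<in> W" using uv(1) by auto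
      then have "card ?X + lam * 2 * ((n - m) choose 2) =
          lam * ((n - 1) choose 2) + lam * ((n - 2) choose 2)"
        using card_triples_touching[OF V(1) W(1) _ _ uv(2), of lam] Z(4) V(2) by (simp add: Z_def)
      moreover have "lam * ((n - 2) choose 2) \<le> lam * 2 * ((n - m) choose 2)"
        using mult_left_mono[OF size(2), of lam] by (simp add: mult.assoc)
      ultimately have "card ?X \<le> lam * ((n - 1) choose 2)" by linarith
      moreover have "{e'\<in>?F. fst e' \<inter> (fst e \<inter> W) \<noteq> {}} = ?X" using uv by auto
      ultimately show ?thesis by (simp only:)
    qed
    then show "fst e \<inter> W \<noteq> {} \<and> card {e'\<in>?F. fst e' \<inter> (fst e \<inter> W) \<noteq> {}} \<le> r * card {1..k}"
      using uv k by simp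
  qed (use finite_E f(2) in auto)
  then obtain g2 where g2: "g2 ` ?F \<subseteq> {1..k}" "\<forall>e\<in>EG. g2 e = f e"
    "\<forall>c\<in>{1..k}. \<forall>w\<in>W. col_deg ?F g2 c w \<le> r" by blast
  have "\<exists>g. g ` E \<subseteq> {1..k} \<and> (\<forall>e\<in>E. 2 \<le> card (fst e \<inter> W) \<longrightarrow> g e = g2 e) \<and>
    (\<forall>c\<in>{1..k}. \<forall>w\<in>W. col_deg E g c w = r) \<and>
    (\<forall>c\<in>{1..k}. (\<Sum>z\<in>Z. col_deg E g c z) = r * card Z)"
  proof (rule ex_amalgamated_coloring)
    show "3 dvd r * (card W + card Z)" using adm mn W Z by (simp add: admissible_def)
    show "card {e\<in>E. v \<in> fst e} = r * card {1..k}" if "v \<in> W \<union> Z" for v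
      using that total_degree[of v] k Z(3) by simp
  qed (use finite_E finite_W Z E_edge size W g2 in auto)
  then obtain g where g: "g ` E \<subseteq> {1..k}" "\<forall>e\<in>E. 2 \<le> card (fst e \<inter> W) \<longrightarrow> g e = g2 e"
    "\<forall>c\<in>{1..k}. \<forall>w\<in>W. col_deg E g c w = r"
    "\<forall>c\<in>{1..k}. (\<Sum>z\<in>Z. col_deg E g c z) = r * card Z" by blast
  have ex: "exchangeable E Z" using V by (intro exchangeable_triples) (auto simp: Z_def)
  \<comment> \<open>Exchanges take place at vertices of \<open>Z\<close> only, so the degrees in
    \<open>W\<close> and the colours of edges inside \<open>W\<close> stay as they are.\<close>
  from ex_balanced_coloring[OF ex finite_atLeastAtMost g(1) bspec[OF g(4)]] obtain g' where
    g': "g' ` E \<subseteq> {1..k}" "\<forall>e\<in>E. fst e \<inter> Z = {} \<longrightarrow> g' e = g e"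
      "\<forall>a v. v \<notin> Z \<longrightarrow> col_deg E g' a v = col_deg E g a v"
      "\<forall>c\<in>{1..k}. \<forall>z\<in>Z. col_deg E g' c z = r" by blast
  have "regular_extension E {1..k} r W Z f g'"
    unfolding regular_extension_def
  proof (intro conjI ballI impI)
    fix e assume e: "e \<in> E" "fst e \<inter> Z = {}"
    then have eG: "e \<in> EG" using E_edge[OF e(1)] by (auto simp: Z_def)
    then have "e \<in> ?F" using EGF by (rule subsetD[rotated])
    then show "g' e = f e" using e g'(2) g(2) bspec[OF g2(2) eG] by simp
  next
    fix c v assume "c \<in> {1..k}" "v \<in> W \<union> Z"
    then show "col_deg E g' c v = r" using g'(3,4) g(3) Z(2) by (cases "v \<in> Z") auto
  qed (use g'(1) in auto)
  moreover have "2 * card W \<le> card Z" "Z \<noteq> {}" using size W Z pos by auto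
  moreover have "fst e \<subseteq> W \<union> Z \<and> card (fst e) = 3" if "e \<in> E" for e
    using E_edge[OF that] Z(3) by simp
  moreover have "\<exists>z\<in>Z. (w, z) \<in> (col_adj E g c)\<^sup>*"
    if "regular_extension E {1..k} r W Z f g" "c \<in> {1..k}" "w \<in> W" for g c w
    using reaches_outside[OF that(1)[unfolded Z_def] that(2,3) bspec[OF irreg that(2)]]
    by (simp only: Z_def)
  ultimately have "\<exists>h. regular_extension E {1..k} r W Z f h \<and> (\<forall>c\<in>{1..k}. col_connected E h c (W \<union> Z))"
    using ex finite_W Z(2) r2 by (intro ex_all_connected) auto
  then obtain h where h: "regular_extension E {1..k} r W Z f h"
    "\<forall>c\<in>{1..k}. col_connected E h c V" using Z(3) by auto
  have "V \<noteq> {}" using pos V W by auto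
  have "connected_factorization r k H h"
    unfolding connected_factorization_iff[OF \<open>V \<noteq> {}\<close>]
    using h Z(3) by (auto simp: regular_extension_def)
  moreover have "\<forall>e\<in>hedges G. h e = f e"
  proof
    fix e assume "e \<in> hedges G"
    then have "e \<in> E" "fst e \<inter> Z = {}" using Z(2) by (auto simp: hedges_G)
    then show "h e = f e" using h(1) by (simp add: regular_extension_def)
  qed
  ultimately show ?thesis unfolding extends_to_connected_factorization_def by blast
qed

end

theorem theorem7p7:
  fixes n m r lam k :: nat
    and gam :: real
    and V W :: "'a set"
    and H G :: "'a hypergraph"
    and f :: "'a set \<times> nat \<Rightarrow> nat"
  assumes "n > 0" and "r > 0" and "lam > 0" and "m > 3"
    and "gam = sqrt (8 * (real m)^2 - 16 * real m - 7)"
    and "real n > 2 * real m + (gam - 1) / 2"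
    and "card V = n" and "W \<subseteq> V" and "card W = m"
    and "H = hg_complete lam 3 V"
    and "G = hg_induced H W"
    and "k = num_colors 3 n r lam"
    and "partial_factorization r k G f"
    and "r = 2 \<Longrightarrow>
           real n \<ge> 3.5 * real m - 3 \<or>
           (\<forall>c \<in> {1..k}. real (card (hg_components (color_class G f c)))
                           \<le> (2 * real m + gam) / 5 + 1)"
  shows "extends_to_connected_factorization r k G H f \<longleftrightarrow>
         admissible 3 n r lam \<and>
         (\<forall>c \<in> {1..k}. \<forall>C \<in> hg_components (color_class G f c). \<not> hg_regular r C)"
proof -
  \<comment> \<open>Infinite sets have cardinality 0, so \<open>n > 0\<close> makes \<open>V\<close>
    finite.\<close>
  have "finite V" using assms(1,7) by (metis card_ge_0_finite)
  note instance_facts = this assms(7-11)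
  note size = size_bounds[OF assms(4) assms(6)[unfolded assms(5)]]
  have f: "f ` {e \<in> triples V lam. fst e \<subseteq> W} \<subseteq> {1..k}"
    using assms(13) partial_factorization_iff[OF instance_facts] by blast
  show ?thesis
  proof
    assume "extends_to_connected_factorization r k G H f"
    then show "admissible 3 n r lam \<and>
         (\<forall>c \<in> {1..k}. \<forall>C \<in> hg_components (color_class G f c). \<not> hg_regular r C)"
      using necessity[OF instance_facts _ f] size assms(3,4) by auto
  next
    assume adm: "admissible 3 n r lam \<and>
         (\<forall>c \<in> {1..k}. \<forall>C \<in> hg_components (color_class G f c). \<not> hg_regular r C)"
    \<comment> \<open>Admissibility makes the truncating division in \<open>num_colors\<close>
      exact.\<close>
    then have "r * k = lam * ((n - 1) choose 2)"
      by (simp add: assms(12) num_colors_def admissible_def)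
    with adm show "extends_to_connected_factorization r k G H f"
      using sufficiency[OF instance_facts assms(13)] size assms(2-4) by auto
  qed
qed

end
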